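(* Let $(\mathbf x,B)$ be a seed of $\mathcal F$, with $\mathbf x=(x_1,\dots,x_m)$. Then the group of units of the cluster algebra $\mathcal A(\mathbf x,B)$ is $$\mathcal A(\mathbf x,B)^\times=\{\lambda\, x_{n+1}^{a_{n+1}}\cdots x_p^{a_p}\mid \lambda\in K^\times,\ a_{n+1},\dots,a_p\in\mathbb Z\}.$$
   Context: Let $K$ be a field of characteristic $0$ or $K=\mathbb Z$. Fix integers $m\ge p\ge n\ge 1$ with $m>1$, and let $\mathcal F=K(X_1,\dots,X_m)$ be the field of rational functions in $m$ variables. For $B=(b_{ij})\in M_{m,n}(\mathbb Z)$ the principal part $B^\circ$ is the $n\times n$ matrix formed by the first $n$ rows. $B$ is connected if the graph with vertices $1,\dots,m$ and an edge between $i$ and $j$ whenever $b_{ij}\neq 0$ or $b_{ji}\ne 0$ is connected. A square integer matrix $A$ is skew-symmetrizable if $DA$ is skew-symmetric for some diagonal integer matrix $D$ with positive diagonal entries. A seed of $\mathcal F$ is a pair $(\mathbf x,B)$ where $B\in M_{m,n}(\mathbb Z)$ is connected with $B^\circ$ skew-symmetrizable, and $\mathbf x=(x_1,\dots,x_m)$ is an $m$-tuple of elements of $\mathcal F$ algebraically independent over $K$. For $1\le k\le n$ the mutation $\mu_k(\mathbf x,B)=(\mathbf x',B')$ is given by $b'_{ij}=-b_{ij}$ if $i=k$ or $j=k$, and $b'_{ij}=b_{ij}+\frac{|b_{ik}|b_{kj}+b_{ik}|b_{kj}|}{2}$ otherwise; $x'_s=x_s$ for $s\neq k$ and $x'_k=x_k^{-1}\big(\prod_{b_{ik}>0}x_i^{b_{ik}}+\prod_{b_{ik}<0}x_i^{-b_{ik}}\big)$.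 Two seeds are mutation equivalent if one is obtained from the other by a finite sequence of mutations $\mu_{i_1},\dots,\mu_{i_t}$ with $1\le i_j\le n$. The cluster algebra $\mathcal A(\mathbf x,B)$ is the $K$-subalgebra of $\mathcal F$ generated by $x_{n+1}^{\pm1},\dots,x_p^{\pm1},x_{p+1},\dots,x_m$ together with all elements $y_1,\dots,y_n$ for all seeds $(\mathbf y,C)$ mutation equivalent to $(\mathbf x,B)$; these $y_i$ are the cluster variables. *)

theory Defs
  imports Main "HOL-Library.Poly_Mapping" "HOL-Computational_Algebra.Fraction_Field"
begin

text \<open>Multivariate polynomials over 'k in variables X_0, X_1, ... (monomials are
  finitely supported exponent vectors), and their fraction field.
  Indices are 0-based: the paper's X_1..X_m are X_0..X_(m-1).\<close>

type_synonym 'k mpoly = "(nat \<Rightarrow>\<^sub>0 nat) \<Rightarrow>\<^sub>0 'k"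
type_synonym 'k ratfun = "'k mpoly fract"

definition mpoly_vars_below :: "nat \<Rightarrow> ('k::zero) mpoly \<Rightarrow> bool" where
  "mpoly_vars_below m P \<longleftrightarrow>
     (\<forall>mon :: nat \<Rightarrow>\<^sub>0 nat. mon \<in> Poly_Mapping.keys P \<longrightarrow> (\<forall>v \<in> Poly_Mapping.keys mon. v < m))"

definition ratF :: "nat \<Rightarrow> ('k::idom) ratfun set" where
  "ratF m = {Fract P Q | P Q. mpoly_vars_below m P \<and> mpoly_vars_below m Q \<and> Q \<noteq> 0}"

definition rconst :: "'k::idom \<Rightarrow> 'k ratfun" where
  "rconst c = Fract (Poly_Mapping.single 0 c) 1"

definition mpoly_eval :: "('k::idom) mpoly \<Rightarrow> (nat \<Rightarrow> 'k ratfun) \<Rightarrow> 'k ratfun" where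
  "mpoly_eval P x =
     (\<Sum>mon \<in> Poly_Mapping.keys P. rconst (Poly_Mapping.lookup P mon) *
        (\<Prod>v \<in> Poly_Mapping.keys (mon :: nat \<Rightarrow>\<^sub>0 nat). x v ^ Poly_Mapping.lookup mon v))"

definition alg_indep :: "nat \<Rightarrow> (nat \<Rightarrow> ('k::idom) ratfun) \<Rightarrow> bool" where
  "alg_indep m x \<longleftrightarrow> (\<forall>P. mpoly_vars_below m P \<longrightarrow> mpoly_eval P x = 0 \<longrightarrow> P = 0)"

text \<open>Matrices B in M_{m,n}(Z) are functions nat => nat => int; only entries
  b i j with i < m, j < n are meaningful.\<close>

definition mat_edge :: "nat \<Rightarrow> nat \<Rightarrow> (nat \<Rightarrow> nat \<Rightarrow> int) \<Rightarrow> nat \<Rightarrow> nat \<Rightarrow> bool" where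
  "mat_edge m n B i j \<longleftrightarrow> i < m \<and> j < m \<and>
     ((j < n \<and> B i j \<noteq> 0) \<or> (i < n \<and> B j i \<noteq> 0))"

definition mat_connected :: "nat \<Rightarrow> nat \<Rightarrow> (nat \<Rightarrow> nat \<Rightarrow> int) \<Rightarrow> bool" where
  "mat_connected m n B \<longleftrightarrow> (\<forall>i<m. \<forall>j<m. (mat_edge m n B)\<^sup>*\<^sup>* i j)"

definition principal_skew_symmetrizable :: "nat \<Rightarrow> (nat \<Rightarrow> nat \<Rightarrow> int) \<Rightarrow> bool" where
  "principal_skew_symmetrizable n B \<longleftrightarrow>
     (\<exists>d :: nat \<Rightarrow> int. (\<forall>i<n. d i > 0) \<and>
        (\<forall>i<n. \<forall>j<n. d i * B i j = - (d j * B j i)))"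

definition is_seed :: "nat \<Rightarrow> nat \<Rightarrow> (nat \<Rightarrow> ('k::idom) ratfun) \<Rightarrow> (nat \<Rightarrow> nat \<Rightarrow> int) \<Rightarrow> bool" where
  "is_seed m n x B \<longleftrightarrow> mat_connected m n B \<and> principal_skew_symmetrizable n B \<and>
     (\<forall>i<m. x i \<in> ratF m) \<and> alg_indep m x"

definition mat_mutate :: "nat \<Rightarrow> (nat \<Rightarrow> nat \<Rightarrow> int) \<Rightarrow> (nat \<Rightarrow> nat \<Rightarrow> int)" where
  "mat_mutate k B = (\<lambda>i j. if i = k \<or> j = k then - B i j
      else B i j + (\<bar>B i k\<bar> * B k j + B i k * \<bar>B k j\<bar>) div 2)"

definition clus_mutate :: "nat \<Rightarrow> nat \<Rightarrow> (nat \<Rightarrow> ('k::idom) ratfun) \<Rightarrow> (nat \<Rightarrow> nat \<Rightarrow> int)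
    \<Rightarrow> (nat \<Rightarrow> 'k ratfun)" where
  "clus_mutate m k x B = x(k := inverse (x k) *
      ((\<Prod>i \<in> {i. i < m \<and> B i k > 0}. x i ^ nat (B i k)) +
       (\<Prod>i \<in> {i. i < m \<and> B i k < 0}. x i ^ nat (- B i k))))"

definition seed_mutate :: "nat \<Rightarrow> nat \<Rightarrow> (nat \<Rightarrow> ('k::idom) ratfun) \<times> (nat \<Rightarrow> nat \<Rightarrow> int)
    \<Rightarrow> (nat \<Rightarrow> 'k ratfun) \<times> (nat \<Rightarrow> nat \<Rightarrow> int)" where
  "seed_mutate m k s = (clus_mutate m k (fst s) (snd s), mat_mutate k (snd s))"

definition mut_step :: "nat \<Rightarrow> nat \<Rightarrow> (nat \<Rightarrow> ('k::idom) ratfun) \<times> (nat \<Rightarrow> nat \<Rightarrow> int)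
    \<Rightarrow> (nat \<Rightarrow> 'k ratfun) \<times> (nat \<Rightarrow> nat \<Rightarrow> int) \<Rightarrow> bool" where
  "mut_step m n s t \<longleftrightarrow> (\<exists>k<n. t = seed_mutate m k s)"

definition mut_equiv :: "nat \<Rightarrow> nat \<Rightarrow> (nat \<Rightarrow> ('k::idom) ratfun) \<times> (nat \<Rightarrow> nat \<Rightarrow> int)
    \<Rightarrow> (nat \<Rightarrow> 'k ratfun) \<times> (nat \<Rightarrow> nat \<Rightarrow> int) \<Rightarrow> bool" where
  "mut_equiv m n = (mut_step m n)\<^sup>*\<^sup>*"

definition cluster_vars :: "nat \<Rightarrow> nat \<Rightarrow> (nat \<Rightarrow> ('k::idom) ratfun) \<Rightarrow> (nat \<Rightarrow> nat \<Rightarrow> int)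
    \<Rightarrow> 'k ratfun set" where
  "cluster_vars m n x B = {fst t i | t i. mut_equiv m n (x, B) t \<and> i < n}"

inductive_set cluster_algebra :: "nat \<Rightarrow> nat \<Rightarrow> nat \<Rightarrow> (nat \<Rightarrow> ('k::idom) ratfun)
    \<Rightarrow> (nat \<Rightarrow> nat \<Rightarrow> int) \<Rightarrow> 'k ratfun set"
  for m p n x B where
  const: "rconst c \<in> cluster_algebra m p n x B"
| inv_frozen: "n \<le> i \<Longrightarrow> i < p \<Longrightarrow> x i \<in> cluster_algebra m p n x B"
| inv_frozen_inv: "n \<le> i \<Longrightarrow> i < p \<Longrightarrow> inverse (x i) \<in> cluster_algebra m p n x B"
| frozen: "p \<le> i \<Longrightarrow> i < m \<Longrightarrow> x i \<in> cluster_algebra m p n x B"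
| clvar: "y \<in> cluster_vars m n x B \<Longrightarrow> y \<in> cluster_algebra m p n x B"
| add: "a \<in> cluster_algebra m p n x B \<Longrightarrow> b \<in> cluster_algebra m p n x B \<Longrightarrow>
     a + b \<in> cluster_algebra m p n x B"
| mult: "a \<in> cluster_algebra m p n x B \<Longrightarrow> b \<in> cluster_algebra m p n x B \<Longrightarrow>
     a * b \<in> cluster_algebra m p n x B"

definition units_of_set :: "'a::comm_ring_1 set \<Rightarrow> 'a set" where
  "units_of_set A = {a \<in> A. \<exists>b \<in> A. a * b = 1}"

text \<open>Hypothesis on K: a field of characteristic 0, or (isomorphic to) Z.\<close>
definition admissible_base :: "'k::idom itself \<Rightarrow> bool" where
  "admissible_base _ \<longleftrightarrow>
     ((\<forall>c::'k. c \<noteq> 0 \<longrightarrow> c dvd 1) \<and> inj (of_nat :: nat \<Rightarrow> 'k)) \<or> bij (of_int :: int \<Rightarrow> 'k)"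

end

theory Submission
  imports Defs Complex_Main
begin

text \<open>By the Laurent phenomenon every element of the cluster algebra is a Laurent polynomial in the
  cluster \<open>x\<close>, polynomial in the variables \<open>x i\<close> with \<open>p \<le> i\<close>, and likewise in each adjacent
  cluster. A unit is therefore a Laurent monomial, with exponent \<open>0\<close> at each \<open>x i\<close> with \<open>p \<le> i\<close>.
  If it had a negative exponent at a mutable variable \<open>x k\<close>, then writing it in the cluster mutated
  at \<open>k\<close> would show that a positive power of the exchange polynomial of \<open>k\<close> divides a monomial; but
  this polynomial is a sum of two distinct monomials because column \<open>k\<close> of \<open>B\<close> is nonzero.

  The Laurent phenomenon is proved by induction on the length of the mutation sequence, following
  Fomin, Williams and Zelevinsky. For a sequence starting with \<open>j\<close>, \<open>k\<close>, the cluster variable is by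
  induction a Laurent polynomial in the cluster \<open>\<mu>\<^sub>j x\<close> and in the cluster \<open>\<mu>\<^sub>j \<mu>\<^sub>k \<mu>\<^sub>j x\<close>. The new
  variables of these clusters are Laurent polynomials in \<open>x\<close>, so it suffices that the one of the
  first cluster is coprime to those of the second. This is arranged by adjoining principal
  coefficients, which are set to \<open>1\<close> afterwards. Identities between integer Laurent polynomials are
  checked at positive real points, where no denominator vanishes.\<close>

section \<open>Evaluation of Laurent polynomials\<close>

type_synonym 'c laurent = "(nat \<Rightarrow>\<^sub>0 int) \<Rightarrow>\<^sub>0 'c"

abbreviation "lookup \<equiv> Poly_Mapping.lookup"
abbreviation "keys \<equiv> Poly_Mapping.keys"
abbreviation "single \<equiv> Poly_Mapping.single"

lemma poly_mapping_eq_sum_single: "f = (\<Sum>a\<in>keys f. single a (lookup f a))"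
  by (rule poly_mapping_eqI)
     (simp add: lookup_sum lookup_single when_def in_keys_iff)

lemma poly_mapping_single_induct [case_names single add]:
  fixes P :: "('a \<Rightarrow>\<^sub>0 'b::comm_monoid_add) \<Rightarrow> bool"
  assumes "\<And>a c. P (single a c)" and "\<And>f g. P f \<Longrightarrow> P g \<Longrightarrow> P (f + g)"
  shows "P f"
proof -
  have "P (\<Sum>a\<in>A. single a (lookup f a))" if "finite A" for A
    using that by (induction A) (use assms(1)[of _ 0] assms in auto)
  then show ?thesis
    by (metis finite_keys poly_mapping_eq_sum_single)
qed

definition mev :: "(nat \<Rightarrow> 'f::field) \<Rightarrow> (nat \<Rightarrow>\<^sub>0 int) \<Rightarrow> 'f" where
  "mev x a = (\<Prod>v\<in>keys a. x v powi lookup a v)"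

text \<open>The coefficient map is a parameter because coefficients of two kinds occur: integers,
  evaluated by \<open>of_int\<close> in any field, and elements of \<open>'k\<close>, evaluated by
  \<open>rconst\<close> in \<open>'k ratfun\<close>.\<close>

definition lev :: "('c::comm_ring_1 \<Rightarrow> 'f::field) \<Rightarrow> (nat \<Rightarrow> 'f) \<Rightarrow> 'c laurent \<Rightarrow> 'f" where
  "lev h x f = (\<Sum>a\<in>keys f. h (lookup f a) * mev x a)"

text \<open>All indices are quantified since exponent vectors carry no bound on their variables. At
  a zero coordinate \<open>mev\<close> need not be multiplicative, because
  \<open>inverse 0 = 0\<close>.\<close>

definition nonvanishing :: "(nat \<Rightarrow> 'f::field) \<Rightarrow> bool" where
  "nonvanishing x \<longleftrightarrow> (\<forall>i. x i \<noteq> 0)"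

lemma nonvanishingD: "nonvanishing x \<Longrightarrow> x i \<noteq> 0"
  by (simp add: nonvanishing_def)

lemma mev_superset: "finite S \<Longrightarrow> keys a \<subseteq> S \<Longrightarrow> mev x a = (\<Prod>v\<in>S. x v powi lookup a v)"
  unfolding mev_def by (rule prod.mono_neutral_left) (auto simp: in_keys_iff)

lemma mev_cong: "(\<And>v. v \<in> keys a \<Longrightarrow> x v = y v) \<Longrightarrow> mev x a = mev y a"
  unfolding mev_def by (rule prod.cong) auto

lemma mev_0 [simp]: "mev x 0 = 1"
  by (simp add: mev_def)

lemma mev_single [simp]: "mev x (single i e) = x i powi e"
  by (simp add: mev_def)

lemma mev_add: "nonvanishing x \<Longrightarrow> mev x (a + b) = mev x a * mev x b"
proof -
  assume x: "nonvanishing x"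
  let ?S = "keys a \<union> keys b"
  have "mev x (a + b) = (\<Prod>v\<in>?S. x v powi lookup (a + b) v)"
    by (rule mev_superset) (auto simp: keys_add)
  also have "\<dots> = (\<Prod>v\<in>?S. x v powi lookup a v * x v powi lookup b v)"
    using x by (intro prod.cong) (auto simp: lookup_add power_int_add nonvanishing_def)
  also have "\<dots> = mev x a * mev x b"
    by (simp add: prod.distrib mev_superset[of ?S a] mev_superset[of ?S b])
  finally show ?thesis .
qed

lemma mev_nonzero [simp]: "nonvanishing x \<Longrightarrow> mev x a \<noteq> 0"
  by (simp add: mev_def nonvanishing_def)

lemma mev_minus: "nonvanishing x \<Longrightarrow> mev x (- a) = inverse (mev x a)"
  using mev_add[of x a "- a"] by (simp add: inverse_unique)

lemma mev_diff: "nonvanishing x \<Longrightarrow> mev x (a - b) = mev x a / mev x b"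
  using mev_add[of x a "- b"] by (simp add: mev_minus divide_inverse)

lemma lev_superset:
  assumes "finite S" "keys f \<subseteq> S" "h 0 = 0"
  shows "lev h x f = (\<Sum>a\<in>S. h (lookup f a) * mev x a)"
  unfolding lev_def using assms by (intro sum.mono_neutral_left) (auto simp: in_keys_iff)

lemma lev_cong:
  "(\<And>a v. a \<in> keys f \<Longrightarrow> v \<in> keys a \<Longrightarrow> x v = y v) \<Longrightarrow> lev h x f = lev h y f"
  unfolding lev_def by (intro sum.cong refl arg_cong2[of _ _ _ _ "(*)"] mev_cong) auto

locale coeff_hom =
  fixes h :: "'c::comm_ring_1 \<Rightarrow> 'f::field"
  assumes h_add: "h (a + b) = h a + h b"
    and h_mult: "h (a * b) = h a * h b"
    and h_one [simp]: "h 1 = 1"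
begin

lemma h_zero [simp]: "h 0 = 0"
  using h_add[of 0 0] by (metis add_cancel_right_left)

lemma h_minus: "h (- a) = - h a"
  using h_add[of a "- a"] by (simp add: eq_neg_iff_add_eq_0 add.commute)

lemma lev_single [simp]: "lev h x (single a c) = h c * mev x a"
  by (cases "c = 0") (simp_all add: lev_def)

lemma lev_0 [simp]: "lev h x 0 = 0"
  by (simp add: lev_def)

lemma lev_1 [simp]: "lev h x 1 = 1"
  using lev_single[of x 0 1] by simp

lemma lev_add [simp]: "lev h x (f + g) = lev h x f + lev h x g"
proof -
  let ?S = "keys f \<union> keys g"
  have "lev h x (f + g) = (\<Sum>a\<in>?S. h (lookup (f + g) a) * mev x a)"
    by (rule lev_superset) (auto simp: keys_add)
  also have "\<dots> = lev h x f + lev h x g"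
    by (simp add: lookup_add h_add distrib_right sum.distrib lev_superset[of ?S f] lev_superset[of ?S g])
  finally show ?thesis .
qed

lemma lev_minus [simp]: "lev h x (- f) = - lev h x f"
  using lev_add[of x f "- f"] by (simp add: eq_neg_iff_add_eq_0 add.commute)

lemma lev_diff [simp]: "lev h x (f - g) = lev h x f - lev h x g"
  using lev_add[of x f "- g"] by simp

lemma lev_sum: "lev h x (sum F A) = (\<Sum>i\<in>A. lev h x (F i))"
  by (induction A rule: infinite_finite_induct) auto

lemma lev_mult [simp]:
  assumes x: "nonvanishing x"
  shows "lev h x (f * g) = lev h x f * lev h x g"
proof (induction f rule: poly_mapping_single_induct)
  case (single a c)
  show ?case
    by (induction g rule: poly_mapping_single_induct)
       (simp_all add: mult_single h_mult mev_add[OF x] algebra_simps)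
qed (simp add: distrib_right)

lemma lev_power [simp]: "nonvanishing x \<Longrightarrow> lev h x (f ^ e) = lev h x f ^ e"
  by (induction e) auto

lemma lev_prod: "nonvanishing x \<Longrightarrow> lev h x (prod F A) = (\<Prod>i\<in>A. lev h x (F i))"
  by (induction A rule: infinite_finite_induct) auto

end

interpretation of_int: coeff_hom "of_int :: int \<Rightarrow> 'f::field"
  by unfold_locales auto

text \<open>Dedekind's independence of characters, the characters being the monomials on the
  multiplicative group of positive real points.\<close>

lemma monomials_independent:
  fixes c :: "(nat \<Rightarrow>\<^sub>0 int) \<Rightarrow> real"
  assumes "finite A" "\<And>x. (\<And>i. x i > 0) \<Longrightarrow> (\<Sum>a\<in>A. c a * mev x a) = 0" "a \<in> A"
  shows "c a = 0"
  using assms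
proof (induction A arbitrary: c a rule: finite_induct)
  case (insert b A)
  have zero: "c a = 0" if "a \<in> A" for a
  proof -
    from that insert.hyps have "a \<noteq> b" by auto
    then obtain i where i: "lookup a i \<noteq> lookup b i"
      by (metis poly_mapping_eqI)
    \<comment> \<open>The point \<open>y\<close> separates the characters \<open>a\<close> and
      \<open>b\<close>: at \<open>y\<close> they are powers of \<open>2\<close> with different
      exponents.\<close>
    define y :: "nat \<Rightarrow> real" where "y = (\<lambda>_. 1)(i := 2)"
    have y: "y j > 0" for j by (simp add: y_def)
    then have y': "nonvanishing y" by (simp add: nonvanishing_def less_imp_neq[symmetric])
    have mev_y: "mev y a = 2 powi lookup a i" for a
      using mev_superset[of "insert i (keys a)" a y]
      by (auto simp: y_def prod.insert_remove intro!: prod.neutral)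
    \<comment> \<open>The relation at the point \<open>x i * y i\<close>, minus
      \<open>mev y b\<close> times the relation at \<open>x\<close>, is a relation without the term
      of \<open>b\<close>.\<close>
    have "c a * (mev y a - mev y b) = 0"
    proof (rule insert.IH[OF _ that])
      fix x :: "nat \<Rightarrow> real" assume x: "\<And>i. x i > 0"
      then have nv: "nonvanishing x" by (simp add: nonvanishing_def less_imp_neq[symmetric])
      have xy: "\<And>i. x i * y i > 0" using x y by simp
      have mult: "mev (\<lambda>i. x i * y i) a = mev x a * mev y a" for a
        by (simp add: mev_def power_int_mult_distrib prod.distrib)
      have "(\<Sum>a\<in>A. c a * (mev y a - mev y b) * mev x a) =
          (\<Sum>a\<in>A. c a * mev (\<lambda>i. x i * y i) a) - mev y b * (\<Sum>a\<in>A. c a * mev x a)"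
        by (simp add: mult algebra_simps sum_subtractf sum_distrib_left)
      also have "\<dots> = - c b * mev (\<lambda>i. x i * y i) b + mev y b * (c b * mev x b)"
        using insert.prems(1)[OF xy] insert.prems(1)[OF x] insert.hyps
        by (simp add: eq_neg_iff_add_eq_0[symmetric])
      also have "\<dots> = 0" by (simp add: mult)
      finally show "(\<Sum>a\<in>A. c a * (mev y a - mev y b) * mev x a) = 0" .
    qed
    moreover have "mev y a \<noteq> mev y b" using i power_int_strict_increasing[of _ _ "2::real"]
      unfolding mev_y by (metis linorder_neqE less_irrefl one_less_numeral_iff semiring_norm(76))
    ultimately show ?thesis by simp
  qed
  have "c b = 0"
    using insert.prems(1)[of "\<lambda>_. 1"] insert.hyps zero by (simp add: mev_def)
  with zero insert.prems(2) show ?case by auto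
qed simp

lemma laurent_eq_0_if_zero_on_positive:
  fixes f :: "int laurent"
  assumes "\<And>x::nat \<Rightarrow> real. (\<And>i. x i > 0) \<Longrightarrow> lev of_int x f = 0"
  shows "f = 0"
proof (rule poly_mapping_eqI)
  fix a
  have "real_of_int (lookup f a) = 0" if "a \<in> keys f"
    using monomials_independent[of "keys f" "\<lambda>a. of_int (lookup f a)" a] assms that
    by (simp add: lev_def)
  then show "lookup f a = lookup 0 a" by (auto simp: in_keys_iff)
qed

section \<open>Restriction of exponents, variables of a Laurent polynomial, and substitution\<close>

definition restr :: "nat set \<Rightarrow> (nat \<Rightarrow>\<^sub>0 int) \<Rightarrow> (nat \<Rightarrow>\<^sub>0 int)" where
  "restr S a = Poly_Mapping.mapp (\<lambda>i e. if i \<in> S then e else 0) a"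

lemma lookup_restr [simp]: "lookup (restr S a) i = (if i \<in> S then lookup a i else 0)"
  by (auto simp: restr_def lookup_mapp when_def in_keys_iff)

lemma keys_restr [simp]: "keys (restr S a) = keys a \<inter> S"
  by (auto simp: in_keys_iff split: if_splits)

lemma mev_restr: "mev x (restr S a) = mev (\<lambda>i. if i \<in> S then x i else 1) a"
proof -
  have "mev x (restr S a) = (\<Prod>v\<in>keys a. x v powi lookup (restr S a) v)"
    by (rule mev_superset) auto
  also have "\<dots> = mev (\<lambda>i. if i \<in> S then x i else 1) a"
    unfolding mev_def by (intro prod.cong) auto
  finally show ?thesis .
qed

lemma mev_split:
  assumes "finite S"
  shows "mev x a = mev x (restr (- S) a) * (\<Prod>i\<in>S. x i powi lookup a i)"
proof -
  have "mev x a = (\<Prod>v\<in>(keys a - S) \<union> S. x v powi lookup a v)"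
    by (rule mev_superset) (use assms in auto)
  also have "\<dots> = (\<Prod>v\<in>keys a - S. x v powi lookup a v) * (\<Prod>v\<in>S. x v powi lookup a v)"
    by (rule prod.union_disjoint) (use assms in auto)
  also have "(\<Prod>v\<in>keys a - S. x v powi lookup a v) = mev x (restr (- S) a)"
    unfolding mev_def by (intro prod.cong) auto
  finally show ?thesis .
qed

lemma mev_fun_upd: "mev (x(j := t)) a = mev x (restr (- {j}) a) * t powi lookup a j"
  using mev_split[of "{j}" "x(j := t)" a] mev_cong[of "restr (- {j}) a" "x(j := t)" x]
  by auto

definition lvars :: "('c::zero) laurent \<Rightarrow> nat set" where
  "lvars f = (\<Union>a\<in>keys f. keys a)"

lemma lvars_single: "lvars (single a c) \<subseteq> keys a"
  by (auto simp: lvars_def)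

lemma lvars_add: "lvars (f + g) \<subseteq> lvars f \<union> lvars g"
  using keys_add[of f g] by (auto simp: lvars_def)

lemma lvars_sum: "lvars (sum F A) \<subseteq> (\<Union>i\<in>A. lvars (F i))"
  by (induction A rule: infinite_finite_induct) (use lvars_add in \<open>force simp: lvars_def\<close>)+

lemma lvars_mult: "lvars (f * g) \<subseteq> lvars f \<union> lvars g"
proof
  fix v assume "v \<in> lvars (f * g)"
  then obtain d where d: "d \<in> keys (f * g)" and v: "v \<in> keys d"
    by (auto simp: lvars_def)
  from d keys_mult[of f g] obtain a b where "d = a + b" "a \<in> keys f" "b \<in> keys g"
    by auto
  with v keys_add[of a b] show "v \<in> lvars f \<union> lvars g" by (auto simp: lvars_def)
qed

lemma lvars_1: "lvars 1 = {}"
  by (simp add: lvars_def)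

lemma lvars_power: "lvars (f ^ e) \<subseteq> lvars f"
  by (induction e) (use lvars_1 lvars_mult in \<open>auto simp: lvars_1\<close>)

lemma lvars_prod: "lvars (prod F A) \<subseteq> (\<Union>i\<in>A. lvars (F i))"
  by (induction A rule: infinite_finite_induct) (use lvars_mult lvars_1 in \<open>force simp: lvars_1\<close>)+

lemma lev_cong_lvars: "(\<And>v. v \<in> lvars f \<Longrightarrow> x v = y v) \<Longrightarrow> lev h x f = lev h y f"
  by (rule lev_cong) (auto simp: lvars_def)

text \<open>Discarding the exponents at indices \<open>i \<ge> m\<close> amounts to setting those
  variables to \<open>1\<close>; this removes principal coefficients.\<close>

definition specialize :: "nat \<Rightarrow> 'c::comm_ring_1 laurent \<Rightarrow> 'c laurent" where
  "specialize m f = (\<Sum>a\<in>keys f. single (restr {..<m} a) (lookup f a))"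

lemma lvars_specialize: "lvars (specialize m f) \<subseteq> {..<m}"
  unfolding specialize_def
  by (rule order_trans[OF lvars_sum], rule UN_least, rule order_trans[OF lvars_single]) auto

lemma (in coeff_hom) lev_specialize:
  "lev h x (specialize m f) = lev h (\<lambda>i. if i < m then x i else 1) f"
  by (simp add: specialize_def lev_sum mev_restr) (simp add: lev_def)

text \<open>Substitution of \<open>\<sigma>\<close> for the variables in \<open>S\<close>, with denominators cleared by the \<open>N\<close>-th power
  of the product of all \<open>\<sigma> i\<close>; the truncation by \<open>nat\<close> is harmless if \<open>N\<close> is large.\<close>

definition lsubst :: "nat \<Rightarrow> nat set \<Rightarrow> (nat \<Rightarrow> 'c laurent) \<Rightarrow> 'c::comm_ring_1 laurent \<Rightarrow> 'c laurent" where
  "lsubst N S \<sigma> f = (\<Sum>a\<in>keys f. single (restr (- S) a) (lookup f a) *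
      (\<Prod>i\<in>S. \<sigma> i ^ nat (lookup a i + int N)))"

lemma lvars_lsubst: "lvars (lsubst N S \<sigma> f) \<subseteq> lvars f \<union> (\<Union>i\<in>S. lvars (\<sigma> i))"
proof -
  have "lvars (single (restr (- S) a) (lookup f a) * (\<Prod>i\<in>S. \<sigma> i ^ nat (lookup a i + int N)))
      \<subseteq> lvars f \<union> (\<Union>i\<in>S. lvars (\<sigma> i))" (is "lvars (?A * ?B) \<subseteq> _") if "a \<in> keys f" for a
  proof -
    have "lvars ?A \<subseteq> lvars f"
      using that lvars_single[of "restr (- S) a" "lookup f a"] by (auto simp: lvars_def)
    moreover have "lvars ?B \<subseteq> (\<Union>i\<in>S. lvars (\<sigma> i))"
      using lvars_power by (intro order_trans[OF lvars_prod]) blast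
    ultimately show ?thesis using lvars_mult[of ?A ?B] by blast
  qed
  then show ?thesis
    unfolding lsubst_def by (intro order_trans[OF lvars_sum] UN_least)
qed

lemma exponents_bounded_below:
  assumes "finite S"
  shows "\<exists>N::nat. \<forall>a\<in>keys f. \<forall>i\<in>S. lookup a i + int N \<ge> 0"
proof (intro exI ballI)
  let ?V = "(\<lambda>(a, i). \<bar>lookup a i\<bar>) ` (keys f \<times> S)"
  fix a i assume "a \<in> keys f" "i \<in> S"
  then have "\<bar>lookup a i\<bar> \<in> ?V" by force
  then have "\<bar>lookup a i\<bar> \<le> Max ?V" using assms by (intro Max_ge) auto
  then show "lookup a i + int (nat (Max ?V)) \<ge> 0" by linarith
qed

lemma (in coeff_hom) lev_lsubst:
  assumes S: "finite S" and x: "nonvanishing x" and \<sigma>: "\<And>i. i \<in> S \<Longrightarrow> lev h x (\<sigma> i) \<noteq> 0"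
    and N: "\<forall>a\<in>keys f. \<forall>i\<in>S. lookup a i + int N \<ge> 0"
  shows "lev h x (lsubst N S \<sigma> f) =
    lev h (\<lambda>i. if i \<in> S then lev h x (\<sigma> i) else x i) f * (\<Prod>i\<in>S. lev h x (\<sigma> i)) ^ N"
proof -
  let ?y = "\<lambda>i. if i \<in> S then lev h x (\<sigma> i) else x i"
  \<comment> \<open>The \<open>N\<close>-th powers are the same for every exponent vector
    \<open>a\<close>, so they can be pulled out of the sum over \<open>keys f\<close>.\<close>
  have *: "mev x (restr (- S) a) * (\<Prod>i\<in>S. lev h x (\<sigma> i) ^ nat (lookup a i + int N)) =
      mev ?y a * (\<Prod>i\<in>S. lev h x (\<sigma> i)) ^ N" if a: "a \<in> keys f" for a
  proof -
    have "(\<Prod>i\<in>S. lev h x (\<sigma> i) ^ nat (lookup a i + int N)) =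
        (\<Prod>i\<in>S. ?y i powi lookup a i * lev h x (\<sigma> i) ^ N)"
    proof (intro prod.cong refl)
      fix i assume i: "i \<in> S"
      have "lev h x (\<sigma> i) ^ nat (lookup a i + int N) = lev h x (\<sigma> i) powi (lookup a i + int N)"
        using N a i by (simp add: power_int_def)
      then show "lev h x (\<sigma> i) ^ nat (lookup a i + int N) = ?y i powi lookup a i * lev h x (\<sigma> i) ^ N"
        using i \<sigma>[OF i] by (simp add: power_int_add)
    qed
    also have "\<dots> = (\<Prod>i\<in>S. ?y i powi lookup a i) * (\<Prod>i\<in>S. lev h x (\<sigma> i)) ^ N"
      by (simp add: prod.distrib prod_power_distrib)
    finally have 1: "(\<Prod>i\<in>S. lev h x (\<sigma> i) ^ nat (lookup a i + int N)) = \<dots>" .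
    have "mev x (restr (- S) a) = mev ?y (restr (- S) a)"
      by (rule mev_cong) auto
    then show ?thesis unfolding mev_split[OF S, of ?y a] 1 by simp
  qed
  have "lev h x (lsubst N S \<sigma> f) = (\<Sum>a\<in>keys f. h (lookup f a) * (mev x (restr (- S) a) *
      (\<Prod>i\<in>S. lev h x (\<sigma> i) ^ nat (lookup a i + int N))))"
    by (simp add: lsubst_def lev_sum x lev_prod mult.assoc)
  also have "\<dots> = (\<Sum>a\<in>keys f. h (lookup f a) * (mev ?y a * (\<Prod>i\<in>S. lev h x (\<sigma> i)) ^ N))"
    by (intro sum.cong refl) (simp add: *)
  finally show ?thesis by (simp add: lev_def sum_distrib_right mult.assoc)
qed

section \<open>Mutation of points\<close>

text \<open>Truncation by \<open>nat\<close> replaces the sign conditions of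
  \<open>clus_mutate\<close>: a factor of the wrong sign gets exponent \<open>0\<close>. The field
  is arbitrary so that real points can be mutated too.\<close>

definition mut_var :: "nat \<Rightarrow> nat \<Rightarrow> (nat \<Rightarrow> 'f::field) \<Rightarrow> (nat \<Rightarrow> nat \<Rightarrow> int) \<Rightarrow> 'f" where
  "mut_var m k x B =
     inverse (x k) * ((\<Prod>i<m. x i ^ nat (B i k)) + (\<Prod>i<m. x i ^ nat (- B i k)))"

definition cmut :: "nat \<Rightarrow> nat \<Rightarrow> (nat \<Rightarrow> 'f::field) \<Rightarrow> (nat \<Rightarrow> nat \<Rightarrow> int) \<Rightarrow> nat \<Rightarrow> 'f" where
  "cmut m k x B = x(k := mut_var m k x B)"

lemma clus_mutate_eq_cmut: "clus_mutate m k x B = cmut m k x B"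
proof -
  have *: "(\<Prod>i\<in>{i. i < m \<and> \<beta> i > 0}. x i ^ nat (\<beta> i)) = (\<Prod>i<m. x i ^ nat (\<beta> i))"
    for \<beta> :: "nat \<Rightarrow> int"
    by (rule prod.mono_neutral_left) (auto, metis linorder_not_less nat_le_0 power_0)
  from *[of "\<lambda>i. B i k"] *[of "\<lambda>i. - B i k"] show ?thesis
    by (simp add: clus_mutate_def cmut_def mut_var_def)
qed

fun path_cluster :: "nat \<Rightarrow> nat list \<Rightarrow> (nat \<Rightarrow> 'f::field) \<Rightarrow> (nat \<Rightarrow> nat \<Rightarrow> int) \<Rightarrow> nat \<Rightarrow> 'f" where
  "path_cluster m [] x B = x"
| "path_cluster m (k # w) x B = path_cluster m w (cmut m k x B) (mat_mutate k B)"

text \<open>The last cluster of the path is not required to be nonvanishing.\<close>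

fun regular_path :: "nat \<Rightarrow> nat list \<Rightarrow> (nat \<Rightarrow> 'f::field) \<Rightarrow> (nat \<Rightarrow> nat \<Rightarrow> int) \<Rightarrow> bool" where
  "regular_path m [] x B \<longleftrightarrow> True"
| "regular_path m (k # w) x B \<longleftrightarrow> nonvanishing x \<and> regular_path m w (cmut m k x B) (mat_mutate k B)"

text \<open>Depending on the signs, the sum is \<open>2 * a * b\<close>, its negative or
  \<open>0\<close>, so the halving is exact.\<close>

lemma half_sum_eq:
  "(\<bar>a\<bar> * b + a * \<bar>b\<bar>) div 2 = (if a > 0 \<and> b > 0 then a * b else if a < 0 \<and> b < 0 then - (a * b) else (0::int))"
  by (auto simp: abs_if)

lemma mat_mutate_eq:
  "mat_mutate k B i j = (if i = k \<or> j = k then - B i j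
     else if B i k > 0 \<and> B k j > 0 then B i j + B i k * B k j
     else if B i k < 0 \<and> B k j < 0 then B i j - B i k * B k j else B i j)"
  by (simp add: mat_mutate_def half_sum_eq)

lemma mat_mutate_mat_mutate [simp]: "mat_mutate k (mat_mutate k B) = B"
  by (intro ext) (auto simp: mat_mutate_eq)

text \<open>The symmetry under negation of \<open>B\<close> later reduces the case
  \<open>B j k < 0\<close> to \<open>B j k > 0\<close>.\<close>

lemma mat_mutate_uminus: "mat_mutate k (\<lambda>i j. - B i j) = (\<lambda>i j. - mat_mutate k B i j)"
  by (intro ext) (auto simp: mat_mutate_eq)

lemma mut_var_uminus: "mut_var m k x (\<lambda>i j. - B i j) = mut_var m k x B"
  by (simp add: mut_var_def add.commute)

lemma cmut_uminus: "cmut m k x (\<lambda>i j. - B i j) = cmut m k x B"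
  by (simp add: cmut_def mut_var_uminus)

lemma skew_sign:
  fixes a b p q :: int
  assumes "a > 0" "b > 0" "a * p = - (b * q)"
  shows "p > 0 \<longleftrightarrow> q < 0" "p < 0 \<longleftrightarrow> q > 0" "p = 0 \<longleftrightarrow> q = 0"
proof -
  have "p > 0 \<longleftrightarrow> a * p > 0" "p < 0 \<longleftrightarrow> a * p < 0" "q > 0 \<longleftrightarrow> b * q > 0" "q < 0 \<longleftrightarrow> b * q < 0"
    using assms(1,2) by (auto simp: zero_less_mult_iff mult_less_0_iff)
  with assms(3) show "p > 0 \<longleftrightarrow> q < 0" "p < 0 \<longleftrightarrow> q > 0" "p = 0 \<longleftrightarrow> q = 0"
    by linarith+
qed

text \<open>The symmetrizer \<open>d\<close> of \<open>B\<close> also serves the mutated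
  matrix.\<close>

lemma skew_symmetrizable_mat_mutate:
  assumes "principal_skew_symmetrizable n B" "k < n"
  shows "principal_skew_symmetrizable n (mat_mutate k B)"
proof -
  obtain d where d: "\<And>i. i < n \<Longrightarrow> d i > 0"
    and skew: "\<And>i j. i < n \<Longrightarrow> j < n \<Longrightarrow> d i * B i j = - (d j * B j i)"
    using assms(1) unfolding principal_skew_symmetrizable_def by blast
  have "d i * mat_mutate k B i j = - (d j * mat_mutate k B j i)" if ij: "i < n" "j < n" for i j
  proof (cases "i = k \<or> j = k")
    case False
    have sign: "B i k > 0 \<longleftrightarrow> B k i < 0" "B i k < 0 \<longleftrightarrow> B k i > 0" if "i < n" for i
      using skew_sign[OF d[OF that] d[OF assms(2)] skew[OF that assms(2)]] by auto
    \<comment> \<open>Both sides equal \<open>- (d k * B k i * B k j)\<close>.\<close>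
    have prod: "d i * (B i k * B k j) = d j * (B j k * B k i)"
      using skew[OF ij(1) assms(2)] skew[OF assms(2) ij(2)]
      by algebra
    show ?thesis
      using False sign[OF ij(1)] sign[OF ij(2)] skew[OF ij] prod
      by (auto simp: mat_mutate_eq distrib_left right_diff_distrib)
  qed (use skew[OF ij] in \<open>auto simp: mat_mutate_eq\<close>)
  with d show ?thesis unfolding principal_skew_symmetrizable_def by blast
qed

lemma skew_symmetrizable_diag:
  assumes "principal_skew_symmetrizable n B" "k < n"
  shows "B k k = 0"
  using assms unfolding principal_skew_symmetrizable_def
  by (metis mult_eq_0_iff neg_equal_zero less_irrefl)

lemma skew_symmetrizable_sign:
  assumes "principal_skew_symmetrizable n B" "j < n" "k < n"
  shows "B j k > 0 \<longleftrightarrow> B k j < 0" "B j k = 0 \<longleftrightarrow> B k j = 0"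
proof -
  obtain d where "d j > 0" "d k > 0" "d j * B j k = - (d k * B k j)"
    using assms unfolding principal_skew_symmetrizable_def by blast
  from skew_sign[OF this] show "B j k > 0 \<longleftrightarrow> B k j < 0" "B j k = 0 \<longleftrightarrow> B k j = 0"
    by auto
qed

text \<open>Since \<open>B k k = 0\<close>, neither exchange monomial contains \<open>x k\<close>,
  and negating column \<open>k\<close> only swaps the two. So the second mutation divides the same
  binomial by the first quotient.\<close>

lemma cmut_cmut:
  assumes "nonvanishing x" "nonvanishing (cmut m k x B)" "B k k = 0"
  shows "cmut m k (cmut m k x B) (mat_mutate k B) = x"
proof -
  have "mut_var m k x B \<noteq> 0"
    using nonvanishingD[OF assms(2), of k] by (simp add: cmut_def)
  moreover have "x k \<noteq> 0" using assms(1) by (simp add: nonvanishing_def)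
  moreover have "(\<Prod>i<m. (x(k := t)) i ^ nat (\<beta> i)) = (\<Prod>i<m. x i ^ nat (\<beta> i))"
    if "\<beta> k = 0" for t and \<beta> :: "nat \<Rightarrow> int"
    by (rule prod.cong) (use that in auto)
  ultimately have "mut_var m k (cmut m k x B) (mat_mutate k B) = x k"
    using assms(3) by (simp add: mut_var_def cmut_def mat_mutate_eq field_simps)
  then show ?thesis by (simp add: cmut_def)
qed

section \<open>Positive real points, where every path is regular\<close>

lemma mut_var_pos:
  assumes "\<And>i. x i > (0::real)"
  shows "mut_var m k x B > 0"
  unfolding mut_var_def using assms by (intro mult_pos_pos add_pos_pos prod_pos) auto

lemma cmut_pos: "(\<And>i. x i > (0::real)) \<Longrightarrow> cmut m k x B i > 0"
  by (simp add: cmut_def mut_var_pos)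

lemma positive_nonvanishing: "(\<And>i. x i > (0::real)) \<Longrightarrow> nonvanishing x"
  by (simp add: nonvanishing_def less_imp_neq[symmetric])

lemma path_cluster_pos: "(\<And>i. x i > (0::real)) \<Longrightarrow> path_cluster m w x B i > 0"
proof (induction w arbitrary: x B)
  case (Cons k w)
  show ?case using Cons.IH[OF cmut_pos[OF Cons.prems]] by simp
qed simp

lemma regular_path_pos: "(\<And>i. x i > (0::real)) \<Longrightarrow> regular_path m w x B"
proof (induction w arbitrary: x B)
  case (Cons k w)
  show ?case using Cons.IH[OF cmut_pos[OF Cons.prems]] positive_nonvanishing[OF Cons.prems] by simp
qed simp

section \<open>Adjoining frozen variables with value 1\<close>

lemma cmut_extend:
  assumes "m \<le> m'" "\<And>i. i < m \<Longrightarrow> x i = y i" "\<And>i. m \<le> i \<Longrightarrow> y i = 1"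
    "\<And>i. i < m \<Longrightarrow> B i k = C i k" "k < m"
  shows "i < m \<Longrightarrow> cmut m k x B i = cmut m' k y C i" "m \<le> i \<Longrightarrow> cmut m' k y C i = 1"
proof -
  have *: "(\<Prod>i<m'. y i ^ nat (\<gamma> i)) = (\<Prod>i<m. x i ^ nat (\<beta> i))"
    if "\<And>i. i < m \<Longrightarrow> \<beta> i = \<gamma> i" for \<beta> \<gamma> :: "nat \<Rightarrow> int"
  proof -
    have "(\<Prod>i<m. x i ^ nat (\<beta> i)) = (\<Prod>i<m. y i ^ nat (\<gamma> i))"
      using assms(2) that by (intro prod.cong) auto
    also have "\<dots> = (\<Prod>i<m'. y i ^ nat (\<gamma> i))"
      using assms(1,3) by (intro prod.mono_neutral_left) auto
    finally show ?thesis by simp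
  qed
  have "mut_var m k x B = mut_var m' k y C"
    unfolding mut_var_def using *[of "\<lambda>i. B i k" "\<lambda>i. C i k"] *[of "\<lambda>i. - B i k" "\<lambda>i. - C i k"] assms(2,4,5)
    by simp
  then show "i < m \<Longrightarrow> cmut m k x B i = cmut m' k y C i" "m \<le> i \<Longrightarrow> cmut m' k y C i = 1"
    using assms by (auto simp: cmut_def)
qed

text \<open>Adjoined variables are never mutated and stay \<open>1\<close>, so the extra rows of
  \<open>C\<close> contribute trivial factors; and the rows \<open>i < m\<close> of a mutated matrix
  depend only on the rows \<open>i < m\<close>. This lets principal coefficients be adjoined and
  removed.\<close>

lemma path_extend:
  assumes "m \<le> m'" "n \<le> m" "set w \<subseteq> {..<n}"
    "\<And>i. i < m \<Longrightarrow> x i = y i" "\<And>i. m \<le> i \<Longrightarrow> y i = 1"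
    "\<And>i j. i < m \<Longrightarrow> j < n \<Longrightarrow> B i j = C i j"
  shows "i < m \<Longrightarrow> path_cluster m w x B i = path_cluster m' w y C i"
    and "regular_path m w x B \<Longrightarrow> regular_path m' w y C"
proof -
  have "(i < m \<longrightarrow> path_cluster m w x B i = path_cluster m' w y C i)
      \<and> (regular_path m w x B \<longrightarrow> regular_path m' w y C)"
    using assms(3-)
  proof (induction w arbitrary: x y B C)
    case (Cons k w)
    have k: "k < n" "k < m" and w: "set w \<subseteq> {..<n}" using Cons.prems(1) assms(2) by auto
    have ext: "i < m \<Longrightarrow> cmut m k x B i = cmut m' k y C i" "m \<le> i \<Longrightarrow> cmut m' k y C i = 1" for i
      using cmut_extend[of m m' x y B k C i] Cons.prems(2-4) k assms(1) by blast+
    have mat: "mat_mutate k B i j = mat_mutate k C i j" if "i < m" "j < n" for i j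
      using Cons.prems(4) that k by (simp add: mat_mutate_eq)
    have nv: "nonvanishing x \<Longrightarrow> nonvanishing y"
      unfolding nonvanishing_def by (metis Cons.prems(2,3) not_le zero_neq_one)
    show ?case
      using Cons.IH[OF w ext mat] nv by simp
  qed auto
  then show "i < m \<Longrightarrow> path_cluster m w x B i = path_cluster m' w y C i"
    "regular_path m w x B \<Longrightarrow> regular_path m' w y C" by auto
qed

section \<open>Divisibility by exchange polynomials\<close>

abbreviation lmon :: "(nat \<Rightarrow>\<^sub>0 int) \<Rightarrow> 'c::comm_ring_1 laurent" where
  "lmon a \<equiv> single a 1"

lemma lmon_mult: "lmon a * lmon b = (lmon (a + b) :: 'c::comm_ring_1 laurent)"
  by (simp add: mult_single)

lemma lmon_power: "lmon a ^ e = (lmon (frag_cmul (int e) a) :: 'c::comm_ring_1 laurent)"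
  by (induction e) (auto simp: lmon_mult frag_cmul_distrib)

text \<open>Modulo \<open>a + b\<close>, the element \<open>a\<close> is congruent to
  \<open>- b\<close>, and so are their powers.\<close>

lemma power_congruence:
  fixes a b :: "'a::comm_ring_1"
  obtains q where "a ^ e = (a + b) * q + (- b) ^ e"
proof
  show "a ^ e = (a + b) * (\<Sum>i<e. (- b) ^ (e - Suc i) * a ^ i) + (- b) ^ e"
    using power_diff_sumr2[of a e "- b"] by (simp add: algebra_simps)
qed

lemma lvars_uminus: "lvars (- f) = lvars (f :: 'c::comm_ring_1 laurent)"
  by (auto simp: lvars_def in_keys_iff)

text \<open>Modulo the binomial, the variable \<open>c\<close> may be replaced by
  \<open>- lmon a\<close>, which does not contain it. A power of the variable, a unit, first clears
  the negative exponents.\<close>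

lemma linear_division:
  fixes f :: "int laurent"
  assumes c: "c \<notin> keys a"
  obtains N q r where "lmon (single c 1) ^ N * f = (lmon (single c 1) + lmon a) * q + r" "c \<notin> lvars r"
proof -
  let ?X = "lmon (single c 1) :: int laurent" and ?A = "lmon a :: int laurent"
  have A: "c \<notin> lvars ((- ?A) ^ e)" for e
    using c lvars_power[of "- ?A" e] lvars_single[of a "1::int"] by (auto simp: lvars_uminus)
  have red: "\<exists>q r'. ?X ^ e * r = (?X + ?A) * q + r' \<and> c \<notin> lvars r'" if r: "c \<notin> lvars r" for e r
  proof -
    obtain q where q: "?X ^ e = (?X + ?A) * q + (- ?A) ^ e" by (rule power_congruence)
    have "?X ^ e * r = (?X + ?A) * (q * r) + (- ?A) ^ e * r"
      by (simp only: q) (simp add: algebra_simps)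
    moreover have "c \<notin> lvars ((- ?A) ^ e * r)"
      using r A lvars_mult by blast
    ultimately show ?thesis by blast
  qed
  have "\<exists>N q r. ?X ^ N * f = (?X + ?A) * q + r \<and> c \<notin> lvars r"
  proof (induction f rule: poly_mapping_single_induct)
    case (single b s)
    let ?b = "restr (- {c}) b"
    \<comment> \<open>One of the two \<open>nat\<close> values is \<open>0\<close>: a negative
      exponent of \<open>c\<close> is cleared, a nonnegative one is left for
      \<open>red\<close>.\<close>
    have "frag_cmul (int (nat (- lookup b c))) (single c 1) + b = frag_cmul (int (nat (lookup b c))) (single c 1) + ?b"
      by (rule poly_mapping_eqI) (simp add: lookup_add lookup_single when_def)
    then have "?X ^ nat (- lookup b c) * single b s = ?X ^ nat (lookup b c) * single ?b s"
      by (simp add: lmon_power mult_single)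
    moreover have "c \<notin> lvars (single ?b s)" using lvars_single[of ?b s] by auto
    ultimately show ?case using red by metis
  next
    case (add f g)
    then obtain N1 q1 r1 N2 q2 r2 where
      1: "?X ^ N1 * f = (?X + ?A) * q1 + r1" "c \<notin> lvars r1" and
      2: "?X ^ N2 * g = (?X + ?A) * q2 + r2" "c \<notin> lvars r2" by blast
    obtain q1' r1' where 3: "?X ^ N2 * r1 = (?X + ?A) * q1' + r1'" "c \<notin> lvars r1'"
      using red 1(2) by blast
    obtain q2' r2' where 4: "?X ^ N1 * r2 = (?X + ?A) * q2' + r2'" "c \<notin> lvars r2'"
      using red 2(2) by blast
    have "?X ^ (N1 + N2) * (f + g) = ?X ^ N2 * (?X ^ N1 * f) + ?X ^ N1 * (?X ^ N2 * g)"
      by (simp add: power_add algebra_simps)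
    also have "\<dots> = (?X + ?A) * (?X ^ N2 * q1 + ?X ^ N1 * q2) + (?X ^ N2 * r1 + ?X ^ N1 * r2)"
      by (simp only: 1(1) 2(1)) (simp add: algebra_simps)
    also have "\<dots> = (?X + ?A) * (?X ^ N2 * q1 + ?X ^ N1 * q2 + q1' + q2') + (r1' + r2')"
      by (simp only: 3(1) 4(1)) (simp add: algebra_simps)
    finally show ?case using 3(2) 4(2) lvars_add[of r1' r2'] by blast
  qed
  then show thesis using that by blast
qed

text \<open>This is primality of the binomial, with \<open>x0\<close> as a certificate that it does
  not divide \<open>w\<close>: the binomial vanishes at \<open>x0\<close> and \<open>w\<close> does
  not.\<close>

lemma linear_dvd_cancel:
  fixes f w :: "int laurent" and x0 :: "nat \<Rightarrow> real"
  assumes c: "c \<notin> keys a"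
    and x0: "nonvanishing x0" "lev of_int x0 (lmon (single c 1) + lmon a) = 0" "lev of_int x0 w \<noteq> 0"
    and dvd: "lmon (single c 1) + lmon a dvd w * f"
  shows "lmon (single c 1) + lmon a dvd f"
proof -
  let ?X = "lmon (single c 1) :: int laurent"
  let ?Z = "?X + lmon a"
  obtain N1 q1 r1 where 1: "?X ^ N1 * w = ?Z * q1 + r1" "c \<notin> lvars r1"
    by (rule linear_division[OF c])
  obtain N2 q2 r2 where 2: "?X ^ N2 * f = ?Z * q2 + r2" "c \<notin> lvars r2"
    by (rule linear_division[OF c])
  have "?Z dvd ?X ^ N1 * ?X ^ N2 * (w * f)" using dvd by (rule dvd_mult)
  also have "?X ^ N1 * ?X ^ N2 * (w * f) = (?X ^ N1 * w) * (?X ^ N2 * f)"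
    by (simp add: algebra_simps)
  also have "\<dots> = ?Z * (q1 * (?Z * q2 + r2) + r1 * q2) + r1 * r2"
    by (simp only: 1(1) 2(1)) (simp add: algebra_simps)
  finally have "?Z dvd r1 * r2" by (simp add: dvd_add_right_iff)
  then obtain q where q: "r1 * r2 = ?Z * q" by (auto simp: dvd_def)
  have "r1 * r2 = 0"
  proof (rule laurent_eq_0_if_zero_on_positive)
    fix x :: "nat \<Rightarrow> real" assume "\<And>i. x i > 0"
    then have x: "nonvanishing x" by (rule positive_nonvanishing)
    \<comment> \<open>The coordinate \<open>c\<close> of \<open>y\<close> solves the linear
      equation, so the binomial vanishes at \<open>y\<close>. The remainders do not contain
      \<open>c\<close> and take the same values at \<open>y\<close> and \<open>x\<close>.\<close>
    define y where "y = x(c := - mev x a)"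
    have y: "nonvanishing y" using x by (simp add: nonvanishing_def y_def mev_def)
    have "mev y a = mev x a" using c by (intro mev_cong) (auto simp: y_def)
    then have "lev of_int y ?Z = 0" by (simp add: y_def)
    then have "lev of_int y (r1 * r2) = 0" using y by (simp add: q)
    moreover have "lev of_int y r1 = lev of_int x r1" "lev of_int y r2 = lev of_int x r2"
      using 1(2) 2(2) by (auto intro!: lev_cong_lvars simp: y_def)
    ultimately show "lev of_int x (r1 * r2) = 0" using x y by simp
  qed
  \<comment> \<open>A zero remainder would make \<open>w\<close> vanish at \<open>x0\<close>, where
    the binomial vanishes and the variable \<open>c\<close> does not.\<close>
  moreover have "r1 \<noteq> 0"
  proof
    assume "r1 = 0"
    then have "lev of_int x0 (?X ^ N1 * w) = lev of_int x0 (?Z * q1)" using 1(1) by simp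
    then show False using x0 by (simp del: of_int.lev_add) (simp add: nonvanishing_def)
  qed
  ultimately have "?X ^ N2 * f = ?Z * q2" using 2(1) by simp
  moreover have "lmon (- frag_cmul (int N2) (single c 1)) * ?X ^ N2 = 1"
    by (simp add: lmon_power lmon_mult del: minus_frag_cmul)
  ultimately have "f = ?Z * (lmon (- frag_cmul (int N2) (single c 1)) * q2)"
    by (metis (no_types, lifting) mult.assoc mult.commute mult_1)
  then show ?thesis by (rule dvdI)
qed

text \<open>One factor is removed at a time; \<open>lmon b\<close> is a unit and does not affect
  divisibility.\<close>

lemma linear_power_dvd_cancel:
  fixes f w z :: "int laurent" and x0 :: "nat \<Rightarrow> real"
  assumes c: "c \<notin> keys a" and z: "z = lmon b * (lmon (single c 1) + lmon a)"
    and x0: "nonvanishing x0" "lev of_int x0 z = 0" "lev of_int x0 w \<noteq> 0"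
    and dvd: "z ^ N dvd w * f"
  shows "z ^ N dvd f"
  using dvd
proof (induction N arbitrary: f)
  case (Suc N)
  let ?Z = "lmon (single c 1) + lmon a :: int laurent"
  have inv: "lmon (- b) * lmon b = (1 :: int laurent)" by (simp add: lmon_mult)
  have Z0: "lev of_int x0 ?Z = 0" using x0 by (simp add: z)
  \<comment> \<open>The value at the all-ones point shows that \<open>z\<close> is nonzero and can
    be cancelled below.\<close>
  have "lev of_int (\<lambda>_. 1 :: real) z = 2"
    by (simp add: z nonvanishing_def mev_def)
  then have "z \<noteq> 0" by auto
  have "z dvd w * f" using Suc.prems by (metis dvd_mult_left power_Suc)
  then have "?Z dvd w * f" unfolding z by (rule dvd_mult_right)
  then have "?Z dvd f" by (rule linear_dvd_cancel[OF c x0(1) Z0 x0(3)])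
  then obtain g where "f = ?Z * g" by (auto simp: dvd_def)
  then have f: "f = z * (lmon (- b) * g)"
    unfolding z by (metis (no_types, lifting) inv mult.assoc mult.commute mult_1)
  have "z * z ^ N dvd z * (w * (lmon (- b) * g))"
    using Suc.prems by (simp add: f ac_simps)
  then have "z ^ N dvd w * (lmon (- b) * g)" using \<open>z \<noteq> 0\<close> by simp
  from Suc.IH[OF this] show ?case by (simp add: f)
qed simp

section \<open>Exchange polynomials and three successive mutations\<close>

definition colexp :: "nat \<Rightarrow> (nat \<Rightarrow> int) \<Rightarrow> (nat \<Rightarrow>\<^sub>0 int)" where
  "colexp m \<beta> = (\<Sum>i<m. single i (int (nat (\<beta> i))))"

lemma lookup_colexp [simp]: "lookup (colexp m \<beta>) i = (if i < m then int (nat (\<beta> i)) else 0)"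
  by (simp add: colexp_def lookup_sum lookup_single when_def)

lemma mev_colexp: "mev x (colexp m \<beta>) = (\<Prod>i<m. x i ^ nat (\<beta> i))"
  by (subst mev_superset[of "{..<m}"]) (auto simp: in_keys_iff power_int_def split: if_splits intro!: prod.cong)

lemma mut_var_mev:
  "mut_var m k x B = inverse (x k) * (mev x (colexp m (\<lambda>i. B i k)) + mev x (colexp m (\<lambda>i. - B i k)))"
  by (simp add: mut_var_def mev_colexp)

text \<open>This is the new cluster variable itself: the exchange binomial divided by the variable
  \<open>k\<close>.\<close>

definition exch :: "nat \<Rightarrow> nat \<Rightarrow> (nat \<Rightarrow> nat \<Rightarrow> int) \<Rightarrow> 'c::comm_ring_1 laurent" where
  "exch m k B = lmon (colexp m (\<lambda>i. B i k) - single k 1) + lmon (colexp m (\<lambda>i. - B i k) - single k 1)"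

lemma (in coeff_hom) lev_exch: "nonvanishing x \<Longrightarrow> lev h x (exch m k B) = mut_var m k x B"
  by (simp add: exch_def mut_var_mev mev_diff divide_inverse algebra_simps)

lemma exch_uminus: "exch m k (\<lambda>i j. - B i j) = exch m k B"
  by (simp add: exch_def add.commute)

text \<open>An entry \<open>1\<close> or \<open>- 1\<close> puts the variable \<open>c\<close> into
  exactly one of the two monomials, to the first power, so the binomial is linear in
  \<open>c\<close> up to a unit.\<close>

lemma exch_linear:
  assumes "c < m" "c \<noteq> j" "\<bar>B c j\<bar> = 1"
  obtains a b where "c \<notin> keys a" "exch m j B = (lmon b * (lmon (single c 1) + lmon a) :: 'c::comm_ring_1 laurent)"
proof -
  have *: "\<exists>a b. c \<notin> keys a \<and> exch m j B = (lmon b * (lmon (single c 1) + lmon a) :: 'c laurent)"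
    if "B c j = 1" for B
  proof (intro exI conjI)
    let ?p = "colexp m (\<lambda>i. B i j)" and ?n = "colexp m (\<lambda>i. - B i j)"
    show "c \<notin> keys (?n - ?p + single c 1)"
      using assms that by (simp add: in_keys_iff lookup_add lookup_minus lookup_single)
    show "exch m j B = (lmon (?p - single j 1 - single c 1) *
        (lmon (single c 1) + lmon (?n - ?p + single c 1)) :: 'c laurent)"
      by (simp add: exch_def distrib_left lmon_mult)
  qed
  consider "B c j = 1" | "B c j = - 1" using assms(3) by linarith
  then show thesis
  proof cases
    case 1 then show thesis using *[of B] that by blast
  next
    case 2 then show thesis using *[of "\<lambda>i j. - B i j"] that by (auto simp: exch_uminus)
  qed
qed

text \<open>The values \<open>u\<close> and \<open>v\<close> are the new cluster variables after the second and third step of the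
  mutation sequence \<open>j\<close>, \<open>k\<close>, \<open>j\<close>; the zero \<open>x0\<close> of the first new variable witnesses
  that they are coprime to it.\<close>

definition exchange_triple :: "nat \<Rightarrow> nat \<Rightarrow> nat \<Rightarrow> (nat \<Rightarrow> nat \<Rightarrow> int) \<Rightarrow>
    int laurent \<Rightarrow> int laurent \<Rightarrow> (nat \<Rightarrow> real) \<Rightarrow> bool" where
  "exchange_triple m j k B u v x0 \<longleftrightarrow>
     (\<forall>x::nat \<Rightarrow> real. (\<forall>i. x i > 0) \<longrightarrow>
        lev of_int x u = mut_var m k (cmut m j x B) (mat_mutate j B) \<and>
        lev of_int x v = mut_var m j (cmut m k (cmut m j x B) (mat_mutate j B))
          (mat_mutate k (mat_mutate j B))) \<and>
     nonvanishing x0 \<and> lev of_int x0 (exch m j B :: int laurent) = 0 \<and>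
     lev of_int x0 u \<noteq> 0 \<and> lev of_int x0 v \<noteq> 0"

text \<open>Modulo the first new variable \<open>z\<close>, \<open>u\<close> reduces to a monomial,
  and the third exchange binomial becomes a monomial times the first one, which is a multiple of
  \<open>z\<close>. The quotient \<open>v\<close> is therefore a Laurent polynomial and is written
  down explicitly.\<close>

lemma exchange_triple_pos:
  assumes jkc: "j < m" "k < m" "c < m" "j \<noteq> k" "c \<noteq> j" "c \<noteq> k"
    and B: "B j j = 0" "B k k = 0" "B j k > 0" "B k j < 0" "\<bar>B c j\<bar> = 1" "B c k = 0"
  shows "\<exists>u v x0. exchange_triple m j k B u v x0"
proof -
  define B1 where "B1 = mat_mutate j B"
  define B2 where "B2 = mat_mutate k B1"
  define s where "s = nat (B j k)"
  define r where "r = nat (- B k j)"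
  have s: "s > 0" "B j k = int s" and r: "r > 0" "B k j = - int r"
    using B by (auto simp: s_def r_def)
  have B1: "B1 j k = - int s" "B1 k j = int r" "B1 k k = 0" "B1 j j = 0" "\<And>i. B1 i j = - B i j"
    using jkc B s r by (auto simp: B1_def mat_mutate_eq)
  have B2: "B2 k j = - int r" "B2 j j = 0"
    "\<And>i. i \<noteq> k \<Longrightarrow> B2 i j = - B i j + int r * int (nat (B1 i k))"
    using jkc B1 r s by (auto simp: B2_def mat_mutate_eq)

  \<comment> \<open>\<open>Ep\<close> and \<open>En\<close> are the exponents of the first exchange
    relation, \<open>W\<close> and \<open>V\<close> of the second, \<open>T\<close> and
    \<open>S\<close> of the third. \<open>V\<close> lacks the variable \<open>j\<close> and
    \<open>S\<close> the variable \<open>k\<close>, whose powers \<open>s\<close> and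
    \<open>r\<close> are put in separately since these variables have been replaced.\<close>
  define z :: "int laurent" where "z = exch m j B"
  define W where "W = colexp m (\<lambda>i. B1 i k)"
  define V where "V = restr (- {j}) (colexp m (\<lambda>i. - B1 i k))"
  define T where "T = colexp m (\<lambda>i. B2 i j)"
  define S where "S = restr (- {k}) (colexp m (\<lambda>i. - B2 i j))"
  define Ep where "Ep = colexp m (\<lambda>i. B i j)"
  define En where "En = colexp m (\<lambda>i. - B i j)"
  define y where "y = z ^ s * lmon V"
  define u where "u = lmon (- single k 1) * (lmon W + y)"
  \<comment> \<open>\<open>D\<close> is the cofactor with
    \<open>y * D = (lmon W + y) ^ r - lmon W ^ r\<close>.\<close>
  define D where "D = (\<Sum>i<r. lmon W ^ (r - Suc i) * (lmon W + y) ^ i)"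
  define v where "v = z ^ (s - 1) * lmon V * D * lmon (S - frag_cmul (int r) (single k 1))
    + lmon (T - En + single j 1)"
  note exps = W_def V_def T_def S_def Ep_def En_def

  have z: "lmon (single j 1) * z = lmon Ep + lmon En"
    by (simp add: z_def exch_def distrib_left lmon_mult Ep_def En_def)
  \<comment> \<open>Away from \<open>j\<close> and \<open>k\<close> this is the formula for
    \<open>B2 i j\<close> above, with \<open>B2 i j\<close> and \<open>B i j\<close> split into
    positive and negative parts.\<close>
  have expo: "frag_cmul (int r) W + (S - frag_cmul (int r) (single k 1)) = T - En + Ep"
  proof (rule poly_mapping_eqI)
    fix i
    consider "i = k" | "i = j" | "i \<noteq> k" "i \<noteq> j" "i < m" | "i \<ge> m" by linarith
    then show "lookup (frag_cmul (int r) W + (S - frag_cmul (int r) (single k 1))) i = lookup (T - En + Ep) i"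
      by cases (use jkc B r s B1 B2 in \<open>auto simp: exps lookup_add lookup_minus lookup_single when_def\<close>)
  qed
  have "lmon (T - En + single j 1) = lmon (T - En) * (lmon (single j 1) :: int laurent)"
    by (simp add: lmon_mult)
  then have "v * z = z ^ s * lmon V * D * lmon (S - frag_cmul (int r) (single k 1))
      + lmon (T - En) * (lmon (single j 1) * z)"
    using s(1) by (cases s) (auto simp: v_def algebra_simps)
  also have "z ^ s * lmon V * D = (lmon W + y) ^ r - lmon W ^ r"
    using power_diff_sumr2[of "lmon W + y" r "lmon W"] by (simp add: D_def y_def)
  also have "lmon (T - En) * (lmon (single j 1) * z) = lmon (T - En + Ep) + lmon T"
    by (simp add: z distrib_left lmon_mult)
  also have "lmon (T - En + Ep) = lmon W ^ r * lmon (S - frag_cmul (int r) (single k 1))"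
    by (simp add: lmon_power lmon_mult expo)
  finally have "v * z = (lmon W + y) ^ r * lmon (S - frag_cmul (int r) (single k 1)) + lmon T"
    by (simp add: algebra_simps)
  also have "S - frag_cmul (int r) (single k 1) = frag_cmul (int r) (- single k 1) + S"
    by (rule poly_mapping_eqI) (simp add: lookup_add lookup_minus)
  also have "(lmon W + y) ^ r * lmon (frag_cmul (int r) (- single k 1) + S) = u ^ r * lmon S"
    by (simp add: u_def power_mult_distrib lmon_power mult.assoc) (simp add: mult.left_commute lmon_mult)
  finally have vz: "v * z = u ^ r * lmon S + lmon T" .

  have points: "lev of_int x u = mut_var m k (cmut m j x B) (mat_mutate j B) \<and>
      lev of_int x v = mut_var m j (cmut m k (cmut m j x B) (mat_mutate j B)) (mat_mutate k (mat_mutate j B))"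
    if pos: "\<And>i. x i > 0" for x :: "nat \<Rightarrow> real"
  proof
    from pos have x: "nonvanishing x" by (rule positive_nonvanishing)
    define x1 where "x1 = cmut m j x B"
    have x1: "x1 = x(j := lev of_int x z)" by (simp add: x1_def cmut_def z_def of_int.lev_exch[OF x])
    have z0: "lev of_int x z \<noteq> 0"
      using mut_var_pos[of x m j B] pos by (simp add: z_def of_int.lev_exch[OF x])
    have W': "restr (- {j}) W = W"
      by (rule poly_mapping_eqI) (auto simp: exps B1)
    have "mut_var m k x1 B1 = inverse (x k) * (mev x W + mev x V * lev of_int x z ^ s)"
      using jkc by (simp add: mut_var_mev x1 mev_fun_upd W_def[symmetric] V_def[symmetric] W')
         (simp add: W_def B1)
    then have u: "lev of_int x u = mut_var m k x1 B1"
      using x by (simp add: u_def y_def mev_minus algebra_simps)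
    then show "lev of_int x u = mut_var m k (cmut m j x B) (mat_mutate j B)"
      by (simp add: x1_def B1_def)
    define x2 where "x2 = cmut m k x1 B1"
    have x2: "x2 = (x(j := lev of_int x z))(k := lev of_int x u)"
      by (simp add: x2_def cmut_def u x1)
    have T': "restr (- {j}) (restr (- {k}) T) = T" "lookup T k = 0"
      using jkc by (auto intro!: poly_mapping_eqI simp: exps B2(1,2))
    have S': "restr (- {j}) S = S" "lookup S j = 0"
      using jkc by (auto intro!: poly_mapping_eqI simp: exps B2(1,2))
    have T'': "lookup T j = 0" by (simp add: exps B2(2))
    have "mut_var m j x2 B2 = inverse (lev of_int x z) * (mev x T + mev x S * lev of_int x u ^ r)"
      using jkc by (simp add: mut_var_mev x2 mev_fun_upd T_def[symmetric] S_def[symmetric] T' T'' S')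
         (simp add: B2)
    also have "\<dots> = lev of_int x v"
      using arg_cong[OF vz, of "lev of_int x"] x z0 by (simp add: field_simps)
    finally show "lev of_int x v =
        mut_var m j (cmut m k (cmut m j x B) (mat_mutate j B)) (mat_mutate k (mat_mutate j B))"
      by (simp add: x2_def x1_def B2_def B1_def)
  qed
  \<comment> \<open>The coordinate \<open>- 1\<close> changes the sign of exactly one of the
    monomials \<open>Ep\<close>, \<open>En\<close>, since \<open>B c j\<close> is \<open>1\<close>
    or \<open>- 1\<close>; so \<open>z\<close> vanishes. The coordinate \<open>1 / 2\<close> gives
    the second term of \<open>v\<close> absolute value \<open>1 / 2\<close>, while that of the first
    is an integer, so the two cannot cancel.\<close>
  define x0 :: "nat \<Rightarrow> real" where "x0 = ((\<lambda>_. 1)(c := - 1))(j := 1 / 2)"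
  have "exchange_triple m j k B u v x0"
    unfolding exchange_triple_def
  proof (intro conjI allI impI)
    show x0: "nonvanishing x0" by (auto simp: nonvanishing_def x0_def)
    have mev_x0: "mev x0 a = (- 1) powi lookup a c" if "lookup a j = 0" for a
    proof -
      have "mev x0 a = (\<Prod>v\<in>insert c (keys a). x0 v powi lookup a v)"
        by (rule mev_superset) auto
      also have "\<dots> = x0 c powi lookup a c * (\<Prod>v\<in>keys a - {c}. x0 v powi lookup a v)"
        by (simp add: prod.insert_remove)
      also have "(\<Prod>v\<in>keys a - {c}. x0 v powi lookup a v) = 1"
        using that by (intro prod.neutral) (auto simp: x0_def in_keys_iff)
      also have "x0 c = - 1" using jkc by (simp add: x0_def)
      finally show ?thesis by simp
    qed
    have abs_mev_x0: "\<bar>mev x0 a\<bar> = 1" if "lookup a j = 0" for a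
      using that by (simp add: mev_x0 power_int_abs)
    have "lev of_int x0 (lmon (single j 1) * z) = 0"
      unfolding z using B jkc by (auto simp: mev_x0 exps abs_if split: if_splits)
    then show z0: "lev of_int x0 (exch m j B :: int laurent) = 0"
      using x0 by (auto simp: nonvanishing_def z_def)
    then have y0: "lev of_int x0 y = 0" using x0 s by (simp add: y_def z_def)
    then show "lev of_int x0 u \<noteq> 0" using x0 by (simp add: u_def)
    show "lev of_int x0 v \<noteq> 0"
    proof
      \<comment> \<open>As \<open>y\<close> vanishes at \<open>x0\<close>, every summand of
        \<open>D\<close> becomes the same power of \<open>lmon W\<close>.\<close>
      have "lev of_int x0 D = (\<Sum>i<r. mev x0 W ^ (r - 1))"
        using x0 y0 unfolding D_def of_int.lev_sum
        by (intro sum.cong) (auto simp: power_add[symmetric])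
      then have D0: "\<bar>lev of_int x0 D\<bar> = real r"
        using abs_mev_x0[of W] by (simp add: abs_mult power_abs exps B1)
      have L: "\<bar>lev of_int x0 (z ^ (s - 1) * lmon V * D * lmon (S - frag_cmul (int r) (single k 1)))\<bar> =
          real (0 ^ (s - 1) * r)"
        using x0 z0 D0 abs_mev_x0[of V] abs_mev_x0[of "S - frag_cmul (int r) (single k 1)"] jkc
        by (simp add: abs_mult power_abs z_def exps B2 lookup_minus lookup_single)
      have R: "\<bar>lev of_int x0 (lmon (T - En + single j 1))\<bar> = 1 / 2"
        using x0 abs_mev_x0[of "T - En"] by (simp add: mev_add abs_mult exps B2 B lookup_minus x0_def)
      assume "lev of_int x0 v = 0"
      then have "real (0 ^ (s - 1) * r) = 1 / 2"
        using L R unfolding v_def of_int.lev_add by linarith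
      then have "real (2 * (0 ^ (s - 1) * r)) = real 1"
        unfolding of_nat_mult[of 2] by simp
      then have "2 * (0 ^ (s - 1) * r) = 1" unfolding of_nat_eq_iff .
      then show False by presburger
    qed
  qed (use points in auto)
  then show ?thesis by blast
qed

text \<open>The mutations at \<open>j\<close> and \<open>k\<close> commute, so \<open>u\<close> is
  the exchange polynomial of \<open>k\<close> for \<open>B\<close>, and the second mutation at
  \<open>j\<close> restores the variable \<open>j\<close>. The sign change at \<open>c\<close> kills
  the first new variable but does not affect column \<open>k\<close>, where
  \<open>B c k = 0\<close>.\<close>

lemma exchange_triple_zero:
  assumes jkc: "j < m" "k < m" "c < m" "j \<noteq> k" "c \<noteq> j" "c \<noteq> k"
    and B: "B j j = 0" "B k k = 0" "B j k = 0" "B k j = 0" "\<bar>B c j\<bar> = 1" "B c k = 0"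
  shows "\<exists>u v x0. exchange_triple m j k B u v x0"
proof -
  have B1: "mat_mutate j B i k = B i k" for i
    using jkc B by (auto simp: mat_mutate_eq)
  have B2: "mat_mutate k (mat_mutate j B) i j = - B i j" for i
    using jkc B by (auto simp: mat_mutate_eq)
  have upd: "mev (x(i := t)) (colexp m \<beta>) = mev x (colexp m \<beta>)" if "\<beta> i = 0"
    for x :: "nat \<Rightarrow> real" and i t and \<beta> :: "nat \<Rightarrow> int"
    using that by (intro mev_cong) (auto simp: in_keys_iff split: if_splits)
  have points: "lev of_int x (exch m k B :: int laurent) = mut_var m k (cmut m j x B) (mat_mutate j B) \<and>
      lev of_int x (lmon (single j 1)) = mut_var m j (cmut m k (cmut m j x B) (mat_mutate j B)) (mat_mutate k (mat_mutate j B))"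
    if pos: "\<And>i. x i > 0" for x :: "nat \<Rightarrow> real"
  proof
    from pos have x: "nonvanishing x" by (rule positive_nonvanishing)
    show "lev of_int x (exch m k B :: int laurent) = mut_var m k (cmut m j x B) (mat_mutate j B)"
      using jkc B by (simp add: of_int.lev_exch[OF x] mut_var_mev B1 cmut_def upd)
    have "mut_var m j x B > 0" using pos by (rule mut_var_pos)
    then show "lev of_int x (lmon (single j 1)) =
        mut_var m j (cmut m k (cmut m j x B) (mat_mutate j B)) (mat_mutate k (mat_mutate j B))"
      using jkc B pos[of j] by (simp add: mut_var_mev B2 cmut_def upd) (simp add: field_simps)
  qed
  define x0 :: "nat \<Rightarrow> real" where "x0 = (\<lambda>_. 1)(c := - 1)"
  have "exchange_triple m j k B (exch m k B) (lmon (single j 1)) x0"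
    unfolding exchange_triple_def
  proof (intro conjI allI impI)
    show x0: "nonvanishing x0" by (auto simp: nonvanishing_def x0_def)
    have mev_x0: "mev x0 a = (- 1) powi lookup a c" for a
      using mev_fun_upd[of "\<lambda>_. 1" c "- 1" a] by (simp add: x0_def mev_def)
    show "lev of_int x0 (exch m j B :: int laurent) = 0"
      using B jkc by (auto simp: of_int.lev_exch[OF x0] mut_var_mev mev_x0 abs_if split: if_splits)
    show "lev of_int x0 (exch m k B :: int laurent) \<noteq> 0"
      using B jkc by (auto simp: of_int.lev_exch[OF x0] mut_var_mev mev_x0) (simp add: x0_def)
    show "lev of_int x0 (lmon (single j 1)) \<noteq> 0" using x0 by (simp add: nonvanishing_def)
  qed (use points in auto)
  then show ?thesis by blast
qed

lemma exchange_triple_exists: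
  assumes jkc: "j < m" "k < m" "c < m" "j \<noteq> k" "c \<noteq> j" "c \<noteq> k"
    and B: "B j j = 0" "B k k = 0" "B j k > 0 \<longleftrightarrow> B k j < 0" "B j k = 0 \<longleftrightarrow> B k j = 0"
      "\<bar>B c j\<bar> = 1" "B c k = 0"
  shows "\<exists>u v x0. exchange_triple m j k B u v x0"
proof -
  consider "B j k > 0" "B k j < 0" | "B j k = 0" "B k j = 0" | "- B j k > 0" "- B k j < 0"
    using B by linarith
  then show ?thesis
  proof cases
    case 1
    from exchange_triple_pos[OF jkc B(1,2) 1 B(5,6)] show ?thesis .
  next
    case 2
    from exchange_triple_zero[OF jkc B(1,2) 2 B(5,6)] show ?thesis .
  next
    case 3
    then have "\<exists>u v x0. exchange_triple m j k (\<lambda>i j. - B i j) u v x0"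
      using B by (intro exchange_triple_pos[OF jkc]) auto
    then show ?thesis
      by (simp add: exchange_triple_def mat_mutate_uminus mut_var_uminus cmut_uminus exch_uminus)
  qed
qed

section \<open>The Laurent phenomenon\<close>

text \<open>One integer Laurent polynomial must serve all regular points. The field is a type
  argument since the same \<open>f\<close> is used over \<open>real\<close>, to test identities, and
  over the field of interest.\<close>

definition expansion :: "'f::field itself \<Rightarrow> nat \<Rightarrow> nat list \<Rightarrow> (nat \<Rightarrow> nat \<Rightarrow> int) \<Rightarrow> nat \<Rightarrow> int laurent \<Rightarrow> bool" where
  "expansion _ m w B i f \<longleftrightarrow>
     (\<forall>x::nat \<Rightarrow> 'f. regular_path m w x B \<longrightarrow> path_cluster m w x B i = lev of_int x f)"

lemma lvars_exch:
  assumes "k < m" shows "lvars (exch m k B) \<subseteq> {..<m}"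
proof -
  have "keys (colexp m \<beta> - single k 1) \<subseteq> {..<m}" for \<beta>
    using assms by (auto simp: in_keys_iff lookup_minus lookup_single when_def split: if_splits)
  then have "lvars (lmon (colexp m \<beta> - single k 1)) \<subseteq> {..<m}" for \<beta>
    by (rule order_trans[OF lvars_single])
  then show ?thesis
    unfolding exch_def by (intro order_trans[OF lvars_add] Un_least)
qed

lemma expansion_Nil: "expansion TYPE('f::field) m [] B i (lmon (single i 1))"
  by (simp add: expansion_def)

lemma expansion_single:
  "expansion TYPE('f::field) m [j] B i (if i = j then exch m j B else lmon (single i 1))"
  by (simp add: expansion_def cmut_def of_int.lev_exch)

lemma expansion_backtrack:
  assumes "expansion TYPE('f::field) m w B i f" "B j j = 0"
  shows "expansion TYPE('f) m (j # j # w) B i f"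
  using assms by (auto simp: expansion_def cmut_cmut)

text \<open>\<open>g\<close> expands the cluster variable in the cluster mutated at
  \<open>j\<close>. Substituting the exchange polynomial brings in a power of it as denominator,
  which assumption \<open>f\<close> cancels; then the variables beyond \<open>m\<close> are set to
  \<open>1\<close>.\<close>

lemma expansion_step:
  assumes "m \<le> m'" "n \<le> m" "set (j # k # w) \<subseteq> {..<n}" "i < m"
    and C: "\<And>i j. i < m \<Longrightarrow> j < n \<Longrightarrow> B i j = C i j"
    and g: "expansion TYPE('f::field) m' (k # w) (mat_mutate j C) i g"
    and N: "\<forall>a\<in>keys g. \<forall>i\<in>{j}. lookup a i + int N \<ge> 0"
    and f: "lsubst N {j} (\<lambda>_. exch m' j C) g = exch m' j C ^ N * f"
  shows "expansion TYPE('f) m (j # k # w) B i (specialize m f)"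
  unfolding expansion_def
proof (intro allI impI)
  fix x :: "nat \<Rightarrow> 'f"
  assume reg: "regular_path m (j # k # w) x B"
  define y where "y = (\<lambda>i. if i < m then x i else 1)"
  have "regular_path m' (j # k # w) y C"
    by (rule path_extend(2)[OF assms(1-3) _ _ C reg]) (auto simp: y_def)
  then have y: "nonvanishing y" and reg': "regular_path m' (k # w) (cmut m' j y C) (mat_mutate j C)"
    by auto
  then have y1: "nonvanishing (cmut m' j y C)" by simp
  let ?z = "lev of_int y (exch m' j C :: int laurent)"
  have z: "?z = mut_var m' j y C" using y by (rule of_int.lev_exch)
  have z0: "?z \<noteq> 0" using nonvanishingD[OF y1, of j] by (simp add: z cmut_def)
  have y1_eq: "cmut m' j y C = (\<lambda>i. if i \<in> {j} then ?z else y i)"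
    by (auto simp: cmut_def z)
  have "path_cluster m (j # k # w) x B i = path_cluster m' (j # k # w) y C i"
    by (rule path_extend(1)[OF assms(1-3) _ _ C assms(4)]) (auto simp: y_def)
  also have "\<dots> = lev of_int (cmut m' j y C) g"
    using g reg' unfolding expansion_def by simp
  also have "\<dots> = lev of_int y f"
    using of_int.lev_lsubst[of "{j}" y "\<lambda>_. exch m' j C" g N] y z0 N
    unfolding y1_eq f by simp
  finally show "path_cluster m (j # k # w) x B i = lev of_int x (specialize m f)"
    by (simp add: of_int.lev_specialize y_def)
qed

text \<open>The same cluster variable is expanded by \<open>g\<close> in the cluster after
  \<open>j\<close>, and by \<open>h\<close> in the cluster after \<open>j\<close>, \<open>k\<close>,
  \<open>j\<close>; the path of \<open>h\<close> begins by undoing the last of these steps. With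
  denominators cleared, \<open>z ^ N\<close> divides the left-hand substitution times a power of
  \<open>v * u\<close>, and \<open>z\<close> is coprime to \<open>v * u\<close>.\<close>

lemma exchange_divides:
  assumes jk: "j < n" "k < n" "j \<noteq> k" and n: "n \<le> m" and "c < m" "n \<le> c"
    and skew: "principal_skew_symmetrizable n B" and c: "B c j = 1" "B c k = 0"
    and g: "expansion TYPE(real) m (k # w) (mat_mutate j B) i g"
    and h: "expansion TYPE(real) m (j # w) (mat_mutate j (mat_mutate k (mat_mutate j B))) i h"
    and N: "\<forall>a\<in>keys g. \<forall>i\<in>{j}. lookup a i + int N \<ge> 0"
  shows "exch m j B ^ N dvd lsubst N {j} (\<lambda>_. exch m j B) g"
proof -
  define B1 where "B1 = mat_mutate j B"
  define B2 where "B2 = mat_mutate k B1"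
  define B3 where "B3 = mat_mutate j B2"
  define z :: "int laurent" where "z = exch m j B"
  have m: "j < m" "k < m" "c \<noteq> j" "c \<noteq> k" using assms by auto
  note diag = skew_symmetrizable_diag[OF skew]
  obtain u v x0 where triple: "exchange_triple m j k B u v x0"
    using exchange_triple_exists[OF m(1,2) \<open>c < m\<close> jk(3) m(3,4) diag[OF jk(1)] diag[OF jk(2)]
        skew_symmetrizable_sign[OF skew jk(1,2)] _ c(2)] c(1) by auto
  have x0: "nonvanishing x0" "lev of_int x0 z = 0" "lev of_int x0 u \<noteq> 0" "lev of_int x0 v \<noteq> 0"
    using triple unfolding exchange_triple_def z_def by auto
  have uv: "lev of_int x u = mut_var m k (cmut m j x B) B1"
      "lev of_int x v = mut_var m j (cmut m k (cmut m j x B) B1) B2"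
      if "\<And>i. x i > 0" for x :: "nat \<Rightarrow> real"
    using triple that unfolding exchange_triple_def B1_def B2_def by auto
  obtain M where M: "\<forall>a\<in>keys h. \<forall>i\<in>{j, k}. lookup a i + int M \<ge> 0"
    using exponents_bounded_below[of "{j, k}" h] by auto
  define \<sigma> where "\<sigma> = (\<lambda>i. if i = j then v else u)"
  \<comment> \<open>At a positive point both products equal the cluster variable times
    \<open>z ^ N * (v * u) ^ M\<close>.\<close>
  have "lsubst N {j} (\<lambda>_. z) g * (v * u) ^ M - lsubst M {j, k} \<sigma> h * z ^ N = 0"
  proof (rule laurent_eq_0_if_zero_on_positive)
    fix x :: "nat \<Rightarrow> real" assume pos: "\<And>i. x i > 0"
    define x1 where "x1 = cmut m j x B"
    define x2 where "x2 = cmut m k x1 B1"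
    define x3 where "x3 = cmut m j x2 B2"
    have pos1: "\<And>i. x1 i > 0" unfolding x1_def using pos by (rule cmut_pos)
    have pos2: "\<And>i. x2 i > 0" unfolding x2_def using pos1 by (rule cmut_pos)
    have pos3: "\<And>i. x3 i > 0" unfolding x3_def using pos2 by (rule cmut_pos)
    have x: "nonvanishing x" "nonvanishing x2" "nonvanishing x3"
      using pos pos2 pos3 by (auto intro: positive_nonvanishing)
    have zx: "lev of_int x z = mut_var m j x B" unfolding z_def using x(1) by (rule of_int.lev_exch)
    have ux: "lev of_int x u = mut_var m k x1 B1" and vx: "lev of_int x v = mut_var m j x2 B2"
      using uv[of x] pos by (auto simp: x1_def x2_def)
    have x1: "x1 = (\<lambda>i. if i \<in> {j} then lev of_int x z else x i)"
      by (auto simp: x1_def cmut_def zx)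
    have "x2 = x1(k := lev of_int x u)" "x3 = x2(j := lev of_int x v)"
      unfolding ux vx by (simp_all only: x2_def x3_def cmut_def)
    then have x3: "x3 = (\<lambda>i. if i \<in> {j, k} then lev of_int x (\<sigma> i) else x i)"
      using jk(3) by (auto simp: x1 \<sigma>_def)
    have nz: "lev of_int x z \<noteq> 0" "lev of_int x u \<noteq> 0" "lev of_int x v \<noteq> 0"
      unfolding zx ux vx using mut_var_pos[of x m j B, OF pos] mut_var_pos[of x1 m k B1, OF pos1]
        mut_var_pos[of x2 m j B2, OF pos2] by linarith+
    define y where "y = path_cluster m w x2 B2 i"
    have "y = path_cluster m (k # w) x1 B1 i"
      by (simp add: y_def x2_def B2_def)
    also have "\<dots> = lev of_int x1 g"
      using g regular_path_pos[of x1] pos1 unfolding expansion_def B1_def by blast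
    finally have y1: "lev of_int x (lsubst N {j} (\<lambda>_. z) g) = y * lev of_int x z ^ N"
      using of_int.lev_lsubst[of "{j}" x "\<lambda>_. z" g N] x(1) nz N by (simp add: x1)
    have "B2 j j = 0"
      unfolding B1_def B2_def using jk skew
      by (intro skew_symmetrizable_diag[of n] skew_symmetrizable_mat_mutate)
    then have "cmut m j x3 B3 = x2"
      unfolding x3_def B3_def using x by (intro cmut_cmut) (auto simp: x3_def)
    then have "y = path_cluster m (j # w) x3 B3 i"
      by (simp add: y_def B3_def)
    also have "\<dots> = lev of_int x3 h"
      using h regular_path_pos[of x3] pos3 unfolding expansion_def B3_def B2_def B1_def by blast
    finally have y3: "lev of_int x (lsubst M {j, k} \<sigma> h) = y * (lev of_int x v * lev of_int x u) ^ M"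
      using of_int.lev_lsubst[of "{j, k}" x \<sigma> h M] x(1) nz M jk(3) by (simp add: x3 \<sigma>_def)
    show "lev of_int x (lsubst N {j} (\<lambda>_. z) g * (v * u) ^ M - lsubst M {j, k} \<sigma> h * z ^ N) = 0"
      using x(1) by (simp add: y1 y3 mult.commute mult.left_commute)
  qed
  then have "lsubst N {j} (\<lambda>_. z) g * (v * u) ^ M = lsubst M {j, k} \<sigma> h * z ^ N"
    by (rule right_minus_eq[THEN iffD1])
  then have dvd: "z ^ N dvd (v * u) ^ M * lsubst N {j} (\<lambda>_. z) g"
    unfolding mult.commute[of "(v * u) ^ M"] by (rule dvdI[OF trans[OF _ mult.commute]])
  obtain a b where a: "c \<notin> keys a" "z = lmon b * (lmon (single c 1) + lmon a)"
    unfolding z_def by (rule exch_linear[OF \<open>c < m\<close> m(3), of B]) (simp add: c)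
  have "lev of_int x0 ((v * u) ^ M) \<noteq> 0" using x0 by simp
  from linear_power_dvd_cancel[OF a x0(1,2) this dvd] show ?thesis unfolding z_def .
qed

text \<open>\<open>m\<close> varies in the induction because the step adjoins \<open>n\<close>
  variables. The expansion over \<open>real\<close> is carried along because divisibility is
  established there.\<close>

theorem laurent_phenomenon:
  assumes "principal_skew_symmetrizable n B" "n \<le> m" "set w \<subseteq> {..<n}" "i < m"
  shows "\<exists>f. lvars f \<subseteq> {..<m} \<and> expansion TYPE(real) m w B i f \<and> expansion TYPE('f::field) m w B i f"
  using assms
proof (induction "length w" arbitrary: m w B rule: less_induct)
  case less
  note skew = less.prems(1) and n = less.prems(2) and w = less.prems(3) and i = less.prems(4)
  have X: "lvars (lmon (single i 1) :: int laurent) \<subseteq> {..<m}"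
    using i by (simp add: lvars_def)
  \<comment> \<open>An immediate repetition cancels, as mutation is an involution. In the essential
    last case the induction hypothesis is applied to the shorter paths \<open>k # w'\<close> and
    \<open>j # w'\<close>.\<close>
  consider "w = []" | j where "w = [j]" | j w' where "w = j # j # w'"
    | j k w' where "w = j # k # w'" "j \<noteq> k"
    by (cases w rule: remdups_adj.cases) blast+
  then show ?case
  proof cases
    case 1
    show ?thesis unfolding 1
      by (intro exI[of _ "lmon (single i 1)"] conjI X expansion_Nil)
  next
    case (2 j)
    have "j < m" using w n 2 by auto
    then have "lvars (if i = j then exch m j B else lmon (single i 1) :: int laurent) \<subseteq> {..<m}"
      using X by (simp add: lvars_exch)
    then show ?thesis unfolding 2
      by (intro exI[of _ "if i = j then exch m j B else lmon (single i 1)"] conjI expansion_single)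
  next
    case (3 j w')
    have Bjj: "B j j = 0" by (rule skew_symmetrizable_diag[OF skew]) (use w 3 in simp)
    have w': "length w' < length w" "set w' \<subseteq> {..<n}" using w 3 by simp_all
    from less.hyps[OF w'(1) skew n w'(2) i] obtain f where f:
      "lvars f \<subseteq> {..<m}" "expansion TYPE(real) m w' B i f" "expansion TYPE('f) m w' B i f" by blast
    show ?thesis unfolding 3
      by (intro exI[of _ f] conjI f(1) expansion_backtrack[where B = B and j = j, OF _ Bjj] f(2,3))
  next
    case (4 j k w')
    have jk: "j < n" "k < n" "j \<noteq> k" and w': "set w' \<subseteq> {..<n}" using w 4 by auto
    define m' where "m' = m + n"
    \<comment> \<open>Principal coefficients make the exchange polynomial linear in the new variable \<open>m + j\<close>.\<close>
    define C where "C = (\<lambda>i l. if i < m then B i l else if i = m + l then 1 else 0)"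
    have C: "B i l = C i l" if "i < m" for i l using that by (simp add: C_def)
    have skewC: "principal_skew_symmetrizable n C"
      using skew n by (simp add: principal_skew_symmetrizable_def C_def)
    have skews: "principal_skew_symmetrizable n (mat_mutate j C)"
      "principal_skew_symmetrizable n (mat_mutate j (mat_mutate k (mat_mutate j C)))"
      by (intro skew_symmetrizable_mat_mutate skewC jk)+
    have len: "length (k # w') < length w" "length (j # w') < length w" using 4 by auto
    have m': "n \<le> m'" "i < m'" using n i by (auto simp: m'_def)
    obtain g where g: "expansion TYPE(real) m' (k # w') (mat_mutate j C) i g"
      "expansion TYPE('f) m' (k # w') (mat_mutate j C) i g"
      using less.hyps[OF len(1) skews(1) m'(1) _ m'(2)] jk w' by auto
    obtain h where h: "expansion TYPE(real) m' (j # w') (mat_mutate j (mat_mutate k (mat_mutate j C))) i h"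
      using less.hyps[OF len(2) skews(2) m'(1) _ m'(2)] jk w' by auto
    obtain N where N: "\<forall>a\<in>keys g. \<forall>i\<in>{j}. lookup a i + int N \<ge> 0"
      using exponents_bounded_below[of "{j}" g] by auto
    have "exch m' j C ^ N dvd lsubst N {j} (\<lambda>_. exch m' j C) g"
      using jk n by (intro exchange_divides[OF jk m'(1) _ _ skewC _ _ g(1) h N, of "m + j"])
        (auto simp: m'_def C_def)
    then obtain f where f: "lsubst N {j} (\<lambda>_. exch m' j C) g = exch m' j C ^ N * f"
      by (auto simp: dvd_def)
    have "expansion TYPE(real) m w B i (specialize m f)" "expansion TYPE('f) m w B i (specialize m f)"
      using expansion_step[OF _ n w[unfolded 4] i C g(1) N f] expansion_step[OF _ n w[unfolded 4] i C g(2) N f] 4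
      by (auto simp: m'_def)
    then show ?thesis using lvars_specialize[of m f] by blast
  qed
qed

section \<open>Behaviour as a frozen variable tends to zero\<close>

lemma mut_var_pos_frozen_zero:
  assumes "\<And>i. i \<noteq> y \<Longrightarrow> l i > (0::real)" "l y \<ge> 0" "k \<noteq> y"
  shows "mut_var m k l B > 0"
proof -
  have nonneg: "(\<Prod>i<m. l i ^ nat (\<beta> i)) \<ge> 0" for \<beta> :: "nat \<Rightarrow> int"
  proof (intro prod_nonneg)
    fix i show "l i ^ nat (\<beta> i) \<ge> 0"
      using assms(1)[of i] assms(2) by (cases "i = y") auto
  qed
  have pos: "(\<Prod>i<m. l i ^ nat (\<beta> i)) > 0" if "\<beta> y \<le> 0" for \<beta> :: "nat \<Rightarrow> int"
  proof (intro prod_pos)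
    fix i show "l i ^ nat (\<beta> i) > 0"
      using assms(1)[of i] that by (cases "i = y") auto
  qed
  \<comment> \<open>The variable \<open>y\<close> occurs in at most one of the two monomials, so the
    other one is positive.\<close>
  have "(\<Prod>i<m. l i ^ nat (B i k)) + (\<Prod>i<m. l i ^ nat (- B i k)) > 0"
    using nonneg[of "\<lambda>i. B i k"] nonneg[of "\<lambda>i. - B i k"] pos[of "\<lambda>i. B i k"] pos[of "\<lambda>i. - B i k"]
    by (cases "B y k \<le> 0") (auto intro: add_pos_nonneg add_nonneg_pos)
  then show ?thesis using assms by (simp add: mut_var_def)
qed

text \<open>Only variables other than \<open>y\<close> are divided by, and their limits remain
  positive along the path.\<close>

lemma path_cluster_tendsto:
  fixes X :: "'a \<Rightarrow> nat \<Rightarrow> real"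
  assumes "y \<notin> set w" "\<And>i. ((\<lambda>t. X t i) \<longlongrightarrow> l i) F" "\<And>i. i \<noteq> y \<Longrightarrow> l i > 0" "l y \<ge> 0"
  shows "((\<lambda>t. path_cluster m w (X t) B i) \<longlongrightarrow> path_cluster m w l B i) F"
  using assms
proof (induction w arbitrary: X l B)
  case (Cons k w)
  have k: "k \<noteq> y" and w: "y \<notin> set w" using Cons.prems(1) by auto
  have lk: "l k \<noteq> 0" using Cons.prems(3)[OF k] by simp
  have "((\<lambda>t. mut_var m k (X t) B) \<longlongrightarrow> mut_var m k l B) F"
    unfolding mut_var_def by (intro tendsto_intros Cons.prems(2) lk)
  then have lim: "((\<lambda>t. cmut m k (X t) B i) \<longlongrightarrow> cmut m k l B i) F" for i
    using Cons.prems(2) by (cases "i = k") (auto simp: cmut_def)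
  have pos: "cmut m k l B i > 0" if "i \<noteq> y" for i
    using mut_var_pos_frozen_zero[of y l k m B] Cons.prems k that by (auto simp: cmut_def)
  have "cmut m k l B y \<ge> 0" using Cons.prems(4) k by (simp add: cmut_def)
  from Cons.IH[of "\<lambda>t. cmut m k (X t) B" "cmut m k l B" "mat_mutate k B", OF w lim pos this]
  show ?case by simp
qed simp

text \<open>As a frozen variable tends to zero, all cluster variables stay bounded; so their Laurent
  expansions have no pole along it.\<close>

lemma expansion_frozen_nonneg:
  assumes exp: "expansion TYPE(real) m w B i f" and y: "y \<notin> set w" and a: "a \<in> keys f"
  shows "lookup a y \<ge> 0"
proof (rule ccontr)
  assume neg: "\<not> lookup a y \<ge> 0"
  \<comment> \<open>\<open>e\<close> is the lowest exponent of \<open>y\<close>, and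
    \<open>A\<close> below collects the terms that attain it. With \<open>t\<close> in place of the
    variable \<open>y\<close>, multiplication by \<open>t ^ nat (- e)\<close> makes the cluster
    variable tend to \<open>0\<close> and its expansion tend to the part from \<open>A\<close>. So
    this part vanishes at every positive point.\<close>
  define e where "e = Min ((\<lambda>a. lookup a y) ` keys f)"
  have e_le: "e \<le> lookup b y" if "b \<in> keys f" for b
    using that by (simp add: e_def)
  have e_neg: "e < 0" using e_le[OF a] neg by linarith
  define A where "A = {b \<in> keys f. lookup b y = e}"
  have "e \<in> (\<lambda>a. lookup a y) ` keys f" unfolding e_def using a by (intro Min_in) auto
  then obtain b where b: "b \<in> A" by (auto simp: A_def)
  have "real_of_int (lookup f b) = 0"
  proof (rule monomials_independent[OF _ _ b])
    show "finite A" by (simp add: A_def)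
    fix x :: "nat \<Rightarrow> real" assume pos: "\<And>i. x i > 0"
    define coe where "coe = (\<lambda>b. real_of_int (lookup f b) * mev x (restr (- {y}) b))"
    let ?F = "at_right (0::real)"
    have ev: "\<forall>\<^sub>F t in ?F. t > 0" by (simp add: eventually_at_right_less)
    have "((\<lambda>t. path_cluster m w (x(y := t)) B i) \<longlongrightarrow> path_cluster m w (x(y := 0)) B i) ?F"
      using pos by (intro path_cluster_tendsto[OF y]) (auto intro!: tendsto_intros)
    then have "((\<lambda>t. t ^ nat (- e) * path_cluster m w (x(y := t)) B i) \<longlongrightarrow>
        0 ^ nat (- e) * path_cluster m w (x(y := 0)) B i) ?F"
      by (intro tendsto_intros)
    moreover have "\<forall>\<^sub>F t in ?F. t ^ nat (- e) * path_cluster m w (x(y := t)) B i =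
        (\<Sum>b\<in>keys f. coe b * t ^ nat (lookup b y - e))"
    proof (rule eventually_mono[OF ev])
      fix t :: real assume t: "t > 0"
      have "regular_path m w (x(y := t)) B" using pos t by (intro regular_path_pos) auto
      then have "path_cluster m w (x(y := t)) B i = (\<Sum>b\<in>keys f. coe b * t powi lookup b y)"
        using exp by (simp add: expansion_def lev_def mev_fun_upd coe_def mult.assoc)
      moreover have "t ^ nat (- e) * t powi lookup b y = t ^ nat (lookup b y - e)" if "b \<in> keys f" for b
        using power_int_add[of t "- e" "lookup b y"] e_neg e_le[OF that] t by (simp add: power_int_def)
      ultimately show "t ^ nat (- e) * path_cluster m w (x(y := t)) B i =
          (\<Sum>b\<in>keys f. coe b * t ^ nat (lookup b y - e))"
        by (simp add: sum_distrib_left mult.left_commute)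
    qed
    moreover have "(0::real) ^ nat (- e) = 0" using e_neg by (simp add: power_0_left)
    ultimately have "((\<lambda>t. \<Sum>b\<in>keys f. coe b * t ^ nat (lookup b y - e)) \<longlongrightarrow> 0) ?F"
      by (simp add: tendsto_cong)
    moreover have "((\<lambda>t. \<Sum>b\<in>keys f. coe b * t ^ nat (lookup b y - e)) \<longlongrightarrow>
        (\<Sum>b\<in>keys f. coe b * 0 ^ nat (lookup b y - e))) ?F"
      by (intro tendsto_intros)
    ultimately have "(\<Sum>b\<in>keys f. coe b * 0 ^ nat (lookup b y - e)) = 0"
      by (rule tendsto_unique[OF trivial_limit_at_right_real, THEN sym])
    \<comment> \<open>Since \<open>0 ^ 0 = 1\<close>, exactly the terms of lowest exponent
      survive.\<close>
    also have "(\<Sum>b\<in>keys f. coe b * 0 ^ nat (lookup b y - e)) =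
        (\<Sum>b\<in>keys f. if lookup b y = e then coe b else 0)"
    proof (intro sum.cong refl)
      fix b assume "b \<in> keys f"
      then have "e \<le> lookup b y" by (rule e_le)
      then show "coe b * 0 ^ nat (lookup b y - e) = (if lookup b y = e then coe b else 0)"
        by (simp add: power_0_left)
    qed
    also have "\<dots> = (\<Sum>b\<in>A. coe b)" by (simp add: A_def sum.inter_filter)
    finally have "(\<Sum>b\<in>A. coe b) = 0" .
    then have "(\<Sum>b\<in>A. coe b * x y powi e) = 0" by (simp add: sum_distrib_right[symmetric])
    also have "(\<Sum>b\<in>A. coe b * x y powi e) = (\<Sum>b\<in>A. real_of_int (lookup f b) * mev x b)"
    proof (intro sum.cong refl)
      fix b assume "b \<in> A"
      then show "coe b * x y powi e = real_of_int (lookup f b) * mev x b"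
        using mev_split[of "{y}" x b] by (simp add: coe_def A_def)
    qed
    finally show "(\<Sum>b\<in>A. real_of_int (lookup f b) * mev x b) = 0" .
  qed
  then show False using b by (auto simp: A_def in_keys_iff)
qed

section \<open>Units of Laurent rings and of the cluster algebra\<close>

interpretation rconst: coeff_hom "rconst :: 'k::idom \<Rightarrow> 'k ratfun"
  by unfold_locales (simp_all add: rconst_def single_add mult_single One_fract_def)

lemma (in coeff_hom) h_of_int: "h (of_int c) = of_int c"
proof -
  have nat: "h (of_nat e) = of_nat e" for e
    by (induction e) (simp_all add: h_add)
  show ?thesis by (cases c rule: int_cases2) (simp_all add: nat h_minus)
qed

definition base_change :: "int laurent \<Rightarrow> 'k::comm_ring_1 laurent" where
  "base_change f = (\<Sum>a\<in>keys f. single a (of_int (lookup f a)))"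

lemma (in coeff_hom) lev_base_change: "lev h x (base_change f) = lev of_int x f"
  by (simp add: base_change_def lev_sum h_of_int) (simp add: lev_def)

lemma lookup_base_change: "lookup (base_change f) a = of_int (lookup f a)"
  by (simp add: base_change_def lookup_sum lookup_single when_def in_keys_iff)

lemma keys_base_change: "keys (base_change f) \<subseteq> keys f"
  by (auto simp: in_keys_iff lookup_base_change)

lemma base_change_eq_0_iff:
  "inj (of_int :: int \<Rightarrow> 'k::comm_ring_1) \<Longrightarrow> base_change f = (0 :: 'k laurent) \<longleftrightarrow> f = 0"
  by (metis (no_types, lifting) injD lookup_base_change lookup_zero of_int_0 poly_mapping_eqI)

section \<open>Units of the Laurent polynomial ring\<close>

lemma lookup_mult_extremal:
  fixes f g :: "'a::cancel_comm_monoid_add \<Rightarrow>\<^sub>0 'c::comm_ring_1"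
  assumes "a \<in> keys f" "b \<in> keys g"
    and uniq: "\<And>a' b'. a' \<in> keys f \<Longrightarrow> b' \<in> keys g \<Longrightarrow> a' + b' = a + b \<Longrightarrow> a' = a"
  shows "lookup (f * g) (a + b) = lookup f a * lookup g b"
proof -
  have "f * g = (\<Sum>a\<in>keys f. single a (lookup f a)) * (\<Sum>b\<in>keys g. single b (lookup g b))"
    by (simp only: poly_mapping_eq_sum_single[symmetric])
  also have "\<dots> = (\<Sum>a\<in>keys f. \<Sum>b\<in>keys g. single (a + b) (lookup f a * lookup g b))"
    by (simp add: sum_product mult_single)
  finally have "lookup (f * g) (a + b) =
      (\<Sum>a'\<in>keys f. \<Sum>b'\<in>keys g. lookup f a' * lookup g b' when a' + b' = a + b)"
    by (simp add: lookup_sum lookup_single)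
  also have "\<dots> = (\<Sum>a'\<in>keys f. if a' = a then (\<Sum>b'\<in>keys g. if b' = b then lookup f a * lookup g b else 0) else 0)"
    using uniq by (intro sum.cong refl) (auto simp: when_def intro!: sum.cong sum.neutral)
  also have "\<dots> = lookup f a * lookup g b"
    using assms(1,2) by simp
  finally show ?thesis .
qed

text \<open>Exponent vectors are linearly ordered compatibly with addition. The product of the two
  largest terms and that of the two smallest cannot cancel, so both have exponent \<open>0\<close>,
  which forces largest and smallest exponents to agree.\<close>

lemma laurent_unit:
  fixes f g :: "'k::idom laurent"
  assumes "f * g = 1"
  obtains a c c' where "f = single a c" "g = single (- a) c'" "c * c' = 1"
proof -
  have ne: "keys f \<noteq> {}" "keys g \<noteq> {}" using assms by auto
  have sum0: "a + b = 0" if "a \<in> keys f" "b \<in> keys g"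
    "\<And>a' b'. a' \<in> keys f \<Longrightarrow> b' \<in> keys g \<Longrightarrow> a' + b' = a + b \<Longrightarrow> a' = a" for a b
  proof -
    have "lookup (f * g) (a + b) = lookup f a * lookup g b"
      using that by (rule lookup_mult_extremal)
    then have "lookup (f * g) (a + b) \<noteq> 0" using that(1,2) by (simp add: in_keys_iff)
    then show ?thesis using assms by (auto simp: lookup_one when_def split: if_splits)
  qed
  define M1 m1 M2 m2 where "M1 = Max (keys f)" and "m1 = Min (keys f)" and "M2 = Max (keys g)" and "m2 = Min (keys g)"
  have in_keys: "M1 \<in> keys f" "m1 \<in> keys f" "M2 \<in> keys g" "m2 \<in> keys g"
    using ne by (auto simp: M1_def m1_def M2_def m2_def)
  have f_le: "m1 \<le> a" "a \<le> M1" if "a \<in> keys f" for a using that by (auto simp: M1_def m1_def)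
  have g_le: "m2 \<le> a" "a \<le> M2" if "a \<in> keys g" for a using that by (auto simp: M2_def m2_def)
  have "M1 + M2 = 0"
  proof (rule sum0[OF in_keys(1,3)])
    fix a b assume "a \<in> keys f" "b \<in> keys g" "a + b = M1 + M2"
    then show "a = M1" using f_le g_le by (metis add_less_le_mono less_irrefl order.not_eq_order_implies_strict)
  qed
  moreover have "m1 + m2 = 0"
  proof (rule sum0[OF in_keys(2,4)])
    fix a b assume "a \<in> keys f" "b \<in> keys g" "a + b = m1 + m2"
    then show "a = m1" using f_le g_le by (metis add_less_le_mono less_irrefl order.not_eq_order_implies_strict)
  qed
  ultimately have eq: "m1 = M1" "m2 = M2"
    using f_le[OF in_keys(1)] g_le[OF in_keys(3)]
    by (metis add_less_le_mono add_le_less_mono less_irrefl order.not_eq_order_implies_strict)+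
  have "keys f = {M1}" "keys g = {M2}"
    using f_le g_le in_keys eq by (auto intro: antisym)
  then have f: "f = single M1 (lookup f M1)" and g: "g = single M2 (lookup g M2)"
    using poly_mapping_eq_sum_single[of f] poly_mapping_eq_sum_single[of g] by simp_all
  have "M2 = - M1" using \<open>M1 + M2 = 0\<close> by (simp add: eq_neg_iff_add_eq_0 add.commute)
  moreover have "lookup f M1 * lookup g M2 = 1"
    using assms \<open>M1 + M2 = 0\<close> by (metis f g mult_single lookup_single_eq lookup_one_zero)
  ultimately show thesis using that f g by metis
qed

text \<open>Multiplying by the \<open>N\<close>-th power of the product of the variables turns
  \<open>f\<close> into an ordinary polynomial. The shift \<open>sh\<close> is injective on
  \<open>keys f\<close>, so no terms merge, and \<open>alg_indep\<close> applies.\<close>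

lemma laurent_independent:
  fixes x :: "nat \<Rightarrow> 'k::idom ratfun"
  assumes indep: "alg_indep m x" and x: "\<And>i. i < m \<Longrightarrow> x i \<noteq> 0"
    and f: "lvars f \<subseteq> {..<m}" "lev rconst x f = 0"
  shows "f = 0"
proof -
  obtain N where N: "\<forall>a\<in>keys f. \<forall>i\<in>{..<m}. lookup a i + int N \<ge> 0"
    using exponents_bounded_below[of "{..<m}" f] by auto
  define sh :: "(nat \<Rightarrow>\<^sub>0 int) \<Rightarrow> (nat \<Rightarrow>\<^sub>0 nat)" where
    "sh a = (\<Sum>i<m. single i (nat (lookup a i + int N)))" for a
  have lookup_sh: "lookup (sh a) i = (if i < m then nat (lookup a i + int N) else 0)" for a i
    by (simp add: sh_def lookup_sum lookup_single when_def)
  have keys_sub: "keys a \<subseteq> {..<m}" if "a \<in> keys f" for a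
    using f(1) that by (auto simp: lvars_def)
  have inj: "inj_on sh (keys f)"
  proof (rule inj_onI, rule poly_mapping_eqI)
    fix a b i assume ab: "a \<in> keys f" "b \<in> keys f" "sh a = sh b"
    show "lookup a i = lookup b i"
    proof (cases "i < m")
      case True
      have "nat (lookup a i + int N) = nat (lookup b i + int N)"
        using arg_cong[OF ab(3), of "\<lambda>s. lookup s i"] True by (simp add: lookup_sh)
      then show ?thesis using N ab True by (simp add: eq_nat_nat_iff)
    next
      case False
      then show ?thesis using keys_sub[OF ab(1)] keys_sub[OF ab(2)] by (metis in_keys_iff lessThan_iff subsetD)
    qed
  qed
  define P where "P = (\<Sum>a\<in>keys f. single (sh a) (lookup f a))"
  have lookup_P: "lookup P (sh a) = lookup f a" if "a \<in> keys f" for a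
  proof -
    have "lookup P (sh a) = (\<Sum>b\<in>keys f. lookup f b when sh b = sh a)"
      by (simp add: P_def lookup_sum lookup_single)
    also have "\<dots> = (\<Sum>b\<in>keys f. if b = a then lookup f a else 0)"
      using inj that by (intro sum.cong) (auto simp: when_def dest: inj_onD)
    finally show ?thesis using that by simp
  qed
  have keys_P: "keys P \<subseteq> sh ` keys f"
    by (auto simp: P_def in_keys_iff lookup_sum lookup_single when_def
        elim!: sum.not_neutral_contains_not_neutral split: if_splits)
  have "mpoly_eval P x = (\<Sum>s\<in>sh ` keys f. rconst (lookup P s) * (\<Prod>v\<in>keys s. x v ^ lookup s v))"
    unfolding mpoly_eval_def
    by (rule sum.mono_neutral_left) (use keys_P in \<open>auto simp: in_keys_iff\<close>)
  also have "\<dots> = (\<Sum>a\<in>keys f. rconst (lookup f a) * (\<Prod>v\<in>keys (sh a). x v ^ lookup (sh a) v))"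
    by (subst sum.reindex[OF inj]) (auto intro!: sum.cong simp: lookup_P)
  also have "\<dots> = (\<Sum>a\<in>keys f. rconst (lookup f a) * mev x a * (\<Prod>i<m. x i) ^ N)"
  proof (intro sum.cong refl)
    fix a assume a: "a \<in> keys f"
    have "(\<Prod>v\<in>keys (sh a). x v ^ lookup (sh a) v) = (\<Prod>v<m. x v ^ lookup (sh a) v)"
      by (rule prod.mono_neutral_left) (auto simp: in_keys_iff lookup_sh split: if_splits)
    also have "\<dots> = (\<Prod>v<m. x v powi lookup a v * x v ^ N)"
    proof (intro prod.cong refl)
      fix v assume v: "v \<in> {..<m}"
      have "x v ^ lookup (sh a) v = x v powi (lookup a v + int N)"
        using N a v by (simp add: lookup_sh power_int_def)
      then show "x v ^ lookup (sh a) v = x v powi lookup a v * x v ^ N"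
        using x v by (simp add: power_int_add)
    qed
    also have "\<dots> = mev x a * (\<Prod>i<m. x i) ^ N"
      using keys_sub[OF a] by (simp add: prod.distrib prod_power_distrib mev_superset[of "{..<m}"])
    finally show "rconst (lookup f a) * (\<Prod>v\<in>keys (sh a). x v ^ lookup (sh a) v) =
        rconst (lookup f a) * mev x a * (\<Prod>i<m. x i) ^ N" by simp
  qed
  also have "\<dots> = 0" using f(2) by (simp add: sum_distrib_right[symmetric] lev_def)
  finally have "mpoly_eval P x = 0" .
  moreover have "mpoly_vars_below m P"
    unfolding mpoly_vars_below_def using keys_P
    by (auto simp: in_keys_iff lookup_sh split: if_splits dest!: subsetD)
  ultimately have "P = 0" using indep by (simp add: alg_indep_def)
  then have "keys f = {}" using lookup_P by (metis equals0I in_keys_iff lookup_zero)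
  then show ?thesis by simp
qed

lemma alg_indep_nonzero:
  assumes "alg_indep m x" "i < m" shows "x i \<noteq> 0"
proof
  assume "x i = 0"
  then have "mpoly_eval (single (single i 1) 1) x = 0" by (simp add: mpoly_eval_def)
  moreover have "mpoly_vars_below m (single (single i 1) 1)"
    using assms(2) by (simp add: mpoly_vars_below_def)
  ultimately have "single (single i 1) 1 = (0 :: 'a mpoly)"
    using assms(1) unfolding alg_indep_def by blast
  then show False by (metis keys_single keys_zero insert_not_empty zero_neq_one)
qed

lemma alg_indep_cong:
  assumes "alg_indep m x" "\<And>i. i < m \<Longrightarrow> y i = x i" shows "alg_indep m y"
proof -
  have "mpoly_eval P y = mpoly_eval P x" if "mpoly_vars_below m P" for P
    using that assms(2) unfolding mpoly_eval_def mpoly_vars_below_def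
    by (intro sum.cong refl arg_cong2[of _ _ _ _ "(*)"] prod.cong) auto
  then show ?thesis using assms(1) unfolding alg_indep_def by metis
qed

section \<open>Grading by the degree in one variable\<close>

definition homog :: "nat \<Rightarrow> int \<Rightarrow> 'k::zero laurent \<Rightarrow> bool" where
  "homog k d f \<longleftrightarrow> (\<forall>a\<in>keys f. lookup a k = d)"

lemma homog_single: "lookup a k = d \<Longrightarrow> homog k d (single a c)"
  by (simp add: homog_def)

lemma homog_add: "homog k d f \<Longrightarrow> homog k d g \<Longrightarrow> homog k d (f + g)"
  using keys_add[of f g] by (auto simp: homog_def)

lemma homog_mult: "homog k d f \<Longrightarrow> homog k e g \<Longrightarrow> homog k (d + e) (f * g)"
  using keys_mult[of f g] by (fastforce simp: homog_def lookup_add)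

lemma homog_power: "homog k d f \<Longrightarrow> homog k (int e * d) (f ^ e)"
proof (induction e)
  case (Suc e)
  then show ?case using homog_mult[of k d f "int e * d" "f ^ e"] by (simp add: distrib_right add.commute)
qed (simp add: homog_def)

definition graded_part :: "nat \<Rightarrow> int \<Rightarrow> 'k::comm_ring_1 laurent \<Rightarrow> 'k laurent" where
  "graded_part k d f = Poly_Mapping.mapp (\<lambda>a c. if lookup a k = d then c else 0) f"

lemma lookup_graded_part: "lookup (graded_part k d f) a = (if lookup a k = d then lookup f a else 0)"
  by (auto simp: graded_part_def lookup_mapp when_def in_keys_iff)

lemma graded_part_sum: "graded_part k d (sum F A) = (\<Sum>i\<in>A. graded_part k d (F i))"
  by (rule poly_mapping_eqI) (simp add: lookup_graded_part lookup_sum)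

lemma graded_part_homog: "homog k e f \<Longrightarrow> graded_part k d f = (if d = e then f else 0)"
  by (rule poly_mapping_eqI) (auto simp: lookup_graded_part homog_def in_keys_iff)

lemma homog_exch:
  assumes "B k k = 0" shows "homog k (- 1) (exch m k B)"
  unfolding exch_def using assms by (intro homog_add homog_single) (auto simp: lookup_minus)

lemma exch_two_terms:
  assumes "i < m" "B i k \<noteq> 0"
  obtains a b where "a \<noteq> b" "lookup (exch m k B) a = (1 :: 'k::comm_ring_1)"
    "lookup (exch m k B) b = (1 :: 'k)"
proof
  let ?a = "colexp m (\<lambda>i. B i k) - single k 1" and ?b = "colexp m (\<lambda>i. - B i k) - single k 1"
  have "lookup ?a i \<noteq> lookup ?b i" using assms by (auto simp: lookup_minus)
  then show ne: "?a \<noteq> ?b" by metis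
  show "lookup (exch m k B) ?a = (1 :: 'k)" "lookup (exch m k B) ?b = (1 :: 'k)"
    unfolding exch_def lookup_add lookup_single using ne by (simp_all add: when_def)
qed

text \<open>Units are single terms, while a nonzero entry in column \<open>k\<close> makes the two
  monomials distinct.\<close>

lemma exch_not_unit:
  assumes "i < m" "B i k \<noteq> 0"
  shows "\<not> exch m k B dvd (1 :: 'k::idom laurent)"
proof
  assume "exch m k B dvd (1 :: 'k laurent)"
  then obtain q where "exch m k B * q = (1 :: 'k laurent)" by (metis dvd_def)
  then obtain d c where z: "exch m k B = (single d c :: 'k laurent)" by (rule laurent_unit)
  obtain a b where "a \<noteq> b" "lookup (exch m k B) a = (1 :: 'k)" "lookup (exch m k B) b = (1 :: 'k)"
    by (rule exch_two_terms[of i m B k, OF assms])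
  then show False by (auto simp: z lookup_single when_def split: if_splits)
qed

text \<open>Comparing the parts of degree \<open>lookup a k - N\<close> in the variable \<open>k\<close>, in which the
  exchange polynomial has degree \<open>- 1\<close>.\<close>

lemma lsubst_exch_monomial:
  fixes h :: "'k::idom laurent"
  assumes eq: "lsubst N {k} (\<lambda>_. exch m k B) h = single a c * exch m k B ^ N"
    and B: "B k k = 0" "i < m" "B i k \<noteq> 0" and c: "c dvd 1"
    and N: "\<forall>b\<in>keys h. \<forall>i\<in>{k}. lookup b i + int N \<ge> 0"
  shows "lookup a k \<ge> 0"
proof (rule ccontr)
  assume "\<not> lookup a k \<ge> 0"
  then obtain e where e: "lookup a k = - int e" "e > 0"
    by (metis neg_int_cases not_less)
  define z :: "'k laurent" where "z = exch m k B"
  have z_pow: "homog k (- int r) (z ^ r)" for r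
    using homog_power[OF homog_exch[of B k m, OF B(1)], of r] by (simp add: z_def)
  \<comment> \<open>\<open>d\<close> is the degree of the right-hand side in the variable
    \<open>k\<close>.\<close>
  define d where "d = - int e - int N"
  define summand where "summand b = single (restr (- {k}) b) (lookup h b) * z ^ nat (lookup b k + int N)" for b
  have "homog k d (single a c * z ^ N)"
    unfolding d_def using homog_mult[OF homog_single[of a k] z_pow[of N]] e by simp
  then have "graded_part k d (single a c * z ^ N) = single a c * z ^ N"
    by (simp add: graded_part_homog)
  moreover have "lsubst N {k} (\<lambda>_. z) h = (\<Sum>b\<in>keys h. summand b)"
    by (simp add: lsubst_def summand_def)
  ultimately have sum: "single a c * z ^ N = (\<Sum>b\<in>keys h. graded_part k d (summand b))"
    using eq graded_part_sum[of k d summand "keys h"] unfolding z_def by metis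
  \<comment> \<open>Only summands with \<open>lookup b k = int e\<close> have degree
    \<open>d\<close>, and each of these contains the factor \<open>z ^ (e + N)\<close>. Cancelling
    \<open>z ^ N\<close> leaves a positive power of \<open>z\<close> dividing a unit.\<close>
  have "z ^ (e + N) dvd graded_part k d (summand b)" if "b \<in> keys h" for b
  proof -
    have "homog k (- (lookup b k + int N)) (summand b)"
      unfolding summand_def
      using homog_mult[OF homog_single[of "restr (- {k}) b" k 0 "lookup h b"] z_pow[of "nat (lookup b k + int N)"]]
        N that by simp
    then have "graded_part k d (summand b) = (if lookup b k = int e then summand b else 0)"
      by (auto simp: graded_part_homog d_def)
    then show ?thesis by (auto simp: summand_def nat_add_distrib)
  qed
  then have "z ^ (e + N) dvd single a c * z ^ N"
    unfolding sum by (rule dvd_sum)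
  moreover have "z \<noteq> 0"
  proof -
    obtain b :: "nat \<Rightarrow>\<^sub>0 int" where "lookup z b = 1"
      unfolding z_def by (rule exch_two_terms[of i m B k, OF B(2,3)])
    then show ?thesis by auto
  qed
  ultimately have "z ^ e dvd single a c" by (simp add: power_add)
  moreover have "single a c dvd 1"
  proof -
    obtain c' where "c * c' = 1" using c by (metis dvd_def)
    then have "single a c * single (- a) c' = 1" by (simp add: mult_single)
    then show ?thesis by (metis dvd_triv_left)
  qed
  moreover have "z dvd z ^ e" using e(2) by simp
  ultimately have "z dvd 1" by (blast intro: dvd_trans)
  then show False using exch_not_unit[of i m B k, OF B(2,3)] unfolding z_def by blast
qed

section \<open>Laurent rings that contain the cluster algebra\<close>

definition adm :: "nat set \<Rightarrow> nat \<Rightarrow> 'k::comm_ring_1 laurent \<Rightarrow> bool" where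
  "adm S m f \<longleftrightarrow> lvars f \<subseteq> {..<m} \<and> (\<forall>a\<in>keys f. \<forall>i\<in>S. lookup a i \<ge> 0)"

lemma adm_add: "adm S m f \<Longrightarrow> adm S m g \<Longrightarrow> adm S m (f + g)"
  using lvars_add[of f g] keys_add[of f g] unfolding adm_def by blast

lemma adm_mult:
  assumes "adm S m f" "adm S m g" shows "adm S m (f * g)"
proof -
  have "lookup d i \<ge> 0" if d: "d \<in> keys (f * g)" and i: "i \<in> S" for d i
  proof -
    obtain a b where "d = a + b" "a \<in> keys f" "b \<in> keys g" using d keys_mult[of f g] by blast
    then show ?thesis using assms i by (simp add: adm_def lookup_add)
  qed
  then show ?thesis using assms lvars_mult[of f g] by (auto simp: adm_def)
qed

lemma adm_single: "keys a \<subseteq> {..<m} \<Longrightarrow> (\<And>i. i \<in> S \<Longrightarrow> lookup a i \<ge> 0) \<Longrightarrow> adm S m (single a c)"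
  by (auto simp: adm_def lvars_def)

text \<open>\<open>S\<close> holds the indices whose variables are not inverted:
  \<open>{p..<m}\<close> for the initial cluster, while \<open>{}\<close> suffices for the adjacent
  ones.\<close>

definition laurent_ring :: "nat set \<Rightarrow> nat \<Rightarrow> (nat \<Rightarrow> 'k::idom ratfun) \<Rightarrow> 'k ratfun set" where
  "laurent_ring S m z = {lev rconst z f | f. adm S m f}"

lemma laurent_ringI: "y = lev rconst z f \<Longrightarrow> adm S m f \<Longrightarrow> y \<in> laurent_ring S m z"
  unfolding laurent_ring_def by blast

lemma laurent_ringE:
  assumes "y \<in> laurent_ring S m z"
  obtains f where "y = lev rconst z f" "adm S m f"
  using assms unfolding laurent_ring_def by blast

lemma laurent_ring_powi:
  assumes "i < m" "i \<in> S \<Longrightarrow> e \<ge> 0"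
  shows "z i powi e \<in> laurent_ring S m z"
  by (rule laurent_ringI[of _ _ "single (single i e) 1"])
     (use assms in \<open>auto intro!: adm_single simp: lookup_single when_def split: if_splits\<close>)

lemma cluster_algebra_subset:
  assumes z: "nonvanishing z"
    and gens: "\<And>i. n \<le> i \<Longrightarrow> i < p \<Longrightarrow> x i \<in> laurent_ring S m z"
      "\<And>i. n \<le> i \<Longrightarrow> i < p \<Longrightarrow> inverse (x i) \<in> laurent_ring S m z"
      "\<And>i. p \<le> i \<Longrightarrow> i < m \<Longrightarrow> x i \<in> laurent_ring S m z"
      "cluster_vars m n x B \<subseteq> laurent_ring S m z"
  shows "cluster_algebra m p n x B \<subseteq> laurent_ring S m z"
proof
  fix y assume "y \<in> cluster_algebra m p n x B"
  then show "y \<in> laurent_ring S m z"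
  proof induction
    case (const c)
    show ?case by (rule laurent_ringI[of _ _ "single 0 c"]) (auto intro: adm_single)
  next
    case (add a b)
    obtain f g where "a = lev rconst z f" "adm S m f" "b = lev rconst z g" "adm S m g"
      using laurent_ringE[OF add.IH(1)] laurent_ringE[OF add.IH(2)] by metis
    then have "a + b = lev rconst z (f + g)" "adm S m (f + g)" by (simp_all add: adm_add)
    then show ?case by (rule laurent_ringI)
  next
    case (mult a b)
    obtain f g where "a = lev rconst z f" "adm S m f" "b = lev rconst z g" "adm S m g"
      using laurent_ringE[OF mult.IH(1)] laurent_ringE[OF mult.IH(2)] by metis
    then have "a * b = lev rconst z (f * g)" "adm S m (f * g)" using z by (simp_all add: adm_mult)
    then show ?case by (rule laurent_ringI)
  qed (use gens in auto)
qed

section \<open>Cluster variables as ends of mutation paths\<close>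

lemma mut_equiv_path:
  assumes "mut_equiv m n s t"
  shows "\<exists>w. set w \<subseteq> {..<n} \<and> fst t = path_cluster m w (fst s) (snd s)"
  using assms unfolding mut_equiv_def
proof (induction rule: converse_rtranclp_induct)
  case base
  show ?case by (rule exI[of _ "[]"]) simp
next
  case (step s s')
  then obtain w k where "set w \<subseteq> {..<n}" "fst t = path_cluster m w (fst s') (snd s')"
    "k < n" "s' = seed_mutate m k s" by (auto simp: mut_step_def)
  then show ?case
    by (intro exI[of _ "k # w"]) (simp add: seed_mutate_def clus_mutate_eq_cmut)
qed

lemma cluster_vars_path:
  assumes "y \<in> cluster_vars m n x B"
  obtains w i where "set w \<subseteq> {..<n}" "i < n" "y = path_cluster m w x B i"
proof -
  obtain t i where t: "mut_equiv m n (x, B) t" and i: "i < n" "y = fst t i"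
    using assms by (auto simp: cluster_vars_def)
  from mut_equiv_path[OF t] obtain w where "set w \<subseteq> {..<n}" "fst t = path_cluster m w x B"
    by auto
  with i show thesis by (intro that) auto
qed

lemma regular_path_snoc:
  "regular_path m (w @ [k]) x B \<longleftrightarrow> regular_path m w x B \<and> nonvanishing (path_cluster m w x B)"
  by (induction w arbitrary: x B) auto

lemma path_cluster_frozen: "i \<notin> set w \<Longrightarrow> path_cluster m w x B i = x i"
  by (induction w arbitrary: x B) (auto simp: cmut_def)

text \<open>As \<open>m > 1\<close>, connectedness gives \<open>k\<close> an edge. If the edge comes
  from row \<open>k\<close>, skew-symmetrizability moves the nonzero entry to column
  \<open>k\<close>.\<close>

lemma connected_column_nonzero:
  assumes "mat_connected m n B" "principal_skew_symmetrizable n B" "m > 1" "n \<le> m" "k < n"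
  obtains i where "i < m" "B i k \<noteq> 0"
proof -
  obtain j where j: "j < m" "j \<noteq> k" using assms(3) by (metis less_trans zero_less_one zero_neq_one)
  have "(mat_edge m n B)\<^sup>*\<^sup>* k j" using assms j by (simp add: mat_connected_def)
  then obtain i where "mat_edge m n B k i" using j(2) by (metis converse_rtranclpE)
  then have i: "i < m" "i < n \<and> B k i \<noteq> 0 \<or> B i k \<noteq> 0" by (auto simp: mat_edge_def)
  then have "B i k \<noteq> 0" using skew_symmetrizable_sign(2)[OF assms(2), of k i] assms(5) by auto
  with i(1) show thesis by (rule that)
qed

text \<open>The values at indices \<open>i \<ge> m\<close> are normalised to \<open>1\<close> so
  that \<open>nonvanishing\<close>, which concerns all indices, can hold.\<close>

locale generic_cluster =
  fixes m n :: nat and x :: "nat \<Rightarrow> 'k::idom ratfun" and B :: "nat \<Rightarrow> nat \<Rightarrow> int"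
  assumes char_0: "inj (of_int :: int \<Rightarrow> 'k)"
    and n_le_m: "n \<le> m"
    and skew: "principal_skew_symmetrizable n B"
    and indep: "alg_indep m x"
    and outside: "\<And>i. m \<le> i \<Longrightarrow> x i = 1"
begin

lemma nonvanishing_x: "nonvanishing x"
  unfolding nonvanishing_def using alg_indep_nonzero[OF indep] outside by (metis not_le zero_neq_one)

lemma independent: "lvars f \<subseteq> {..<m} \<Longrightarrow> lev rconst x f = 0 \<Longrightarrow> f = 0"
  by (rule laurent_independent[OF indep]) (use nonvanishing_x in \<open>auto simp: nonvanishing_def\<close>)

lemma independent_eq:
  assumes "lvars f \<subseteq> {..<m}" "lvars g \<subseteq> {..<m}" "lev rconst x f = lev rconst x g"
  shows "f = g"
proof -
  have "lvars (f - g) \<subseteq> {..<m}"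
    using lvars_add[of f "- g"] assms(1,2) by (auto simp: lvars_uminus)
  moreover have "lev rconst x (f - g) = 0" using assms(3) by simp
  ultimately have "f - g = 0" by (rule independent)
  then show ?thesis by simp
qed

lemma path_nonvanishing:
  assumes reg: "regular_path m w x B" and w: "set w \<subseteq> {..<n}"
  shows "nonvanishing (path_cluster m w x B)"
  unfolding nonvanishing_def
proof
  fix i
  show "path_cluster m w x B i \<noteq> 0"
  proof (cases "i < m")
    case True
    obtain f where f: "lvars f \<subseteq> {..<m}" "expansion TYPE(real) m w B i f"
      "expansion TYPE('k ratfun) m w B i f"
      using laurent_phenomenon[OF skew n_le_m w True] by blast
    \<comment> \<open>the expansion is nonzero because it is positive at the point \<open>(1, 1, \<dots>)\<close>\<close>
    have "lev of_int (\<lambda>_. 1 :: real) f > 0"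
      using f(2) path_cluster_pos[of "\<lambda>_. 1" m w B i] regular_path_pos[of "\<lambda>_. 1" m w B]
      by (simp add: expansion_def)
    then have "f \<noteq> 0" by auto
    then have "base_change f \<noteq> (0 :: 'k laurent)" using base_change_eq_0_iff[OF char_0] by blast
    moreover have "lvars (base_change f :: 'k laurent) \<subseteq> {..<m}"
      using f(1) keys_base_change[of f] by (auto simp: lvars_def)
    ultimately have "lev rconst x (base_change f) \<noteq> 0" using independent by blast
    then show ?thesis using f(3) reg by (simp add: expansion_def rconst.lev_base_change)
  next
    case False
    then have "i \<notin> set w" using w n_le_m by auto
    then show ?thesis using False outside by (simp add: path_cluster_frozen)
  qed
qed

text \<open>A regular path ends in a nonvanishing cluster, hence stays regular when one more
  mutation is appended.\<close>

lemma regular_path_x: "set w \<subseteq> {..<n} \<Longrightarrow> regular_path m w x B"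
  by (induction w rule: rev_induct) (simp_all add: regular_path_snoc path_nonvanishing)

lemma nonvanishing_cmut: "k < n \<Longrightarrow> nonvanishing (cmut m k x B)"
  using path_nonvanishing[of "[k]"] regular_path_x[of "[k]"] by simp

lemma path_in_laurent_ring:
  assumes w: "set w \<subseteq> {..<n}" and i: "i < m" and C: "principal_skew_symmetrizable n C"
    and S: "S \<inter> {..<n} = {}" and reg: "regular_path m w z C"
  shows "path_cluster m w z C i \<in> laurent_ring S m (z :: nat \<Rightarrow> 'k ratfun)"
proof -
  obtain f where f: "lvars f \<subseteq> {..<m}" "expansion TYPE(real) m w C i f"
    "expansion TYPE('k ratfun) m w C i f"
    using laurent_phenomenon[OF C n_le_m w i] by blast
  have "lookup a j \<ge> 0" if "a \<in> keys f" "j \<in> S" for a j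
    using expansion_frozen_nonneg[OF f(2) _ that(1)] w S that(2) by blast
  then have "adm S m (base_change f :: 'k laurent)"
    using f(1) keys_base_change[of f] unfolding adm_def lvars_def by blast
  moreover have "path_cluster m w z C i = lev rconst z (base_change f)"
    using f(3) reg by (simp add: expansion_def rconst.lev_base_change)
  ultimately show ?thesis by (intro laurent_ringI)
qed

text \<open>Seen from the mutated cluster, the path first mutates back at \<open>k\<close> and then
  follows \<open>w\<close>.\<close>

lemma path_in_mutated_laurent_ring:
  assumes w: "set w \<subseteq> {..<n}" and i: "i < m" and k: "k < n"
  shows "path_cluster m w x B i \<in> laurent_ring {} m (cmut m k x B)"
proof -
  have Bkk: "B k k = 0" using skew k by (rule skew_symmetrizable_diag)
  have x': "cmut m k (cmut m k x B) (mat_mutate k B) = x"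
    by (rule cmut_cmut[OF nonvanishing_x nonvanishing_cmut[OF k] Bkk])
  have "path_cluster m (k # w) (cmut m k x B) (mat_mutate k B) i \<in> laurent_ring {} m (cmut m k x B)"
    using w k by (intro path_in_laurent_ring i skew_symmetrizable_mat_mutate skew)
      (auto simp: x' nonvanishing_cmut regular_path_x)
  then show ?thesis by (simp add: x')
qed

text \<open>Once denominators are cleared, independence turns the equality of values at
  \<open>x\<close> into an identity of Laurent polynomials, to which the degree argument of
  \<open>lsubst_exch_monomial\<close> applies.\<close>

lemma monomial_in_mutated_ring:
  assumes in_ring: "rconst c * mev x a \<in> laurent_ring {} m (cmut m k x B)"
    and c: "c dvd 1" and a: "keys a \<subseteq> {..<m}"
    and k: "k < n" and i: "i < m" "B i k \<noteq> 0"
  shows "lookup a k \<ge> 0"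
proof -
  obtain h where h: "rconst c * mev x a = lev rconst (cmut m k x B) h" "adm {} m h"
    using in_ring by (rule laurent_ringE)
  obtain N where N: "\<forall>b\<in>keys h. \<forall>i\<in>{k}. lookup b i + int N \<ge> 0"
    using exponents_bounded_below[of "{k}" h] by auto
  define z :: "'k laurent" where "z = exch m k B"
  have z: "lev rconst x z = mut_var m k x B"
    unfolding z_def using nonvanishing_x by (rule rconst.lev_exch)
  have z0: "lev rconst x z \<noteq> 0"
    using nonvanishingD[OF nonvanishing_cmut[OF k], of k] by (simp add: z cmut_def)
  have lvars_z: "lvars z \<subseteq> {..<m}" unfolding z_def using k n_le_m by (intro lvars_exch) simp
  have eq: "lsubst N {k} (\<lambda>_. z) h = single a c * z ^ N"
  proof (rule independent_eq)
    show "lvars (lsubst N {k} (\<lambda>_. z) h) \<subseteq> {..<m}"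
      using lvars_lsubst[of N "{k}" "\<lambda>_. z" h] lvars_z h(2) by (auto simp: adm_def)
    show "lvars (single a c * z ^ N) \<subseteq> {..<m}"
      using lvars_mult[of "single a c" "z ^ N"] lvars_single[of a c] lvars_power[of z N] lvars_z a by blast
    have "cmut m k x B = (\<lambda>i. if i \<in> {k} then lev rconst x z else x i)"
      by (auto simp: cmut_def z)
    then show "lev rconst x (lsubst N {k} (\<lambda>_. z) h) = lev rconst x (single a c * z ^ N)"
      using rconst.lev_lsubst[of "{k}" x "\<lambda>_. z" h N] nonvanishing_x z0 N h(1) by simp
  qed
  have "B k k = 0" using skew k by (rule skew_symmetrizable_diag)
  then show ?thesis
    using lsubst_exch_monomial[of N k m B h a c i, folded z_def, OF eq] i c N by blast
qed

end

section \<open>The group of units of the cluster algebra\<close>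

lemma cluster_algebra_powi:
  assumes "n \<le> i" "i < p"
  shows "x i powi e \<in> cluster_algebra m p n x B"
proof -
  have pow: "y ^ r \<in> cluster_algebra m p n x B" if "y \<in> cluster_algebra m p n x B" for y r
  proof (induction r)
    case 0
    show ?case using cluster_algebra.const[of 1] by simp
  next
    case (Suc r)
    then show ?case using that by (simp add: cluster_algebra.mult)
  qed
  show ?thesis
    unfolding power_int_def using assms
    by (auto intro: pow cluster_algebra.inv_frozen cluster_algebra.inv_frozen_inv)
qed

lemma frozen_monomial_in_cluster_algebra:
  "rconst c * (\<Prod>i\<in>{n..<p}. x i powi a i) \<in> cluster_algebra m p n x B"
proof -
  have "(\<Prod>i\<in>I. x i powi a i) \<in> cluster_algebra m p n x B" if "finite I" "I \<subseteq> {n..<p}" for I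
    using that
  proof (induction I rule: finite_induct)
    case empty
    show ?case using cluster_algebra.const[of 1] by simp
  next
    case (insert i I)
    then show ?case by (auto intro!: cluster_algebra.mult cluster_algebra_powi)
  qed
  then show ?thesis by (intro cluster_algebra.mult cluster_algebra.const) auto
qed

theorem theorem2p2:
  fixes m p n :: nat and x :: "nat \<Rightarrow> ('k::idom) ratfun" and B :: "nat \<Rightarrow> nat \<Rightarrow> int"
  assumes "admissible_base TYPE('k)"
    and "m \<ge> p" and "p \<ge> n" and "n \<ge> 1" and "m > 1"
    and "is_seed m n x B"
  shows "units_of_set (cluster_algebra m p n x B) =
    {rconst c * (\<Prod>i \<in> {n..<p}. x i powi a i) | (c :: 'k) (a :: nat \<Rightarrow> int). c dvd 1}"
proof (intro equalityI subsetI)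
  let ?A = "cluster_algebra m p n x B"
  have seed: "mat_connected m n B" "principal_skew_symmetrizable n B" "alg_indep m x"
    using assms(6) by (auto simp: is_seed_def)
  have x_nz: "x i \<noteq> 0" if "i < m" for i using seed(3) that by (rule alg_indep_nonzero)
  {
    fix y assume "y \<in> {rconst c * (\<Prod>i \<in> {n..<p}. x i powi a i) | (c :: 'k) (a :: nat \<Rightarrow> int). c dvd 1}"
    then obtain c a c' where y: "y = rconst c * (\<Prod>i \<in> {n..<p}. x i powi a i)" and c: "c * c' = 1"
      by (auto simp: dvd_def)
    have "y * (rconst c' * (\<Prod>i \<in> {n..<p}. x i powi (- a i))) =
        (rconst c * rconst c') * (\<Prod>i \<in> {n..<p}. x i powi a i * x i powi (- a i))"
      by (simp add: y prod.distrib)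
    also have "\<dots> = 1"
      using x_nz assms(2) by (simp add: rconst.h_mult[symmetric] c power_int_minus)
    finally have "y * (rconst c' * (\<Prod>i \<in> {n..<p}. x i powi (- a i))) = 1" .
    moreover have "y \<in> ?A" unfolding y by (rule frozen_monomial_in_cluster_algebra)
    moreover have "rconst c' * (\<Prod>i \<in> {n..<p}. x i powi (- a i)) \<in> ?A"
      by (rule frozen_monomial_in_cluster_algebra)
    ultimately show "y \<in> units_of_set ?A" unfolding units_of_set_def by blast
  next
    fix u assume "u \<in> units_of_set ?A"
    then obtain v where u: "u \<in> ?A" and v: "v \<in> ?A" and uv: "u * v = 1"
      by (auto simp: units_of_set_def)
    \<comment> \<open>only the values \<open>x i\<close> with \<open>i < m\<close> are meaningful; the others may be zero\<close>
    define X where "X = (\<lambda>i. if i < m then x i else 1)"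
    have X: "X i = x i" if "i < m" for i using that by (simp add: X_def)
    have "inj (of_int :: int \<Rightarrow> 'k)"
    proof -
      consider "inj (of_nat :: nat \<Rightarrow> 'k)" | "bij (of_int :: int \<Rightarrow> 'k)"
        using assms(1) by (auto simp: admissible_base_def)
      then show ?thesis
      proof cases
        case 1
        have zero: "i = 0" if "of_int i = (0 :: 'k)" for i
        proof -
          have "of_nat (nat \<bar>i\<bar>) = (of_nat 0 :: 'k)"
            using that by (cases "i \<ge> 0") simp_all
          then have "nat \<bar>i\<bar> = 0" using 1 by (simp only: inj_eq)
          then show ?thesis by simp
        qed
        show ?thesis
        proof (rule injI)
          fix i j assume "of_int i = (of_int j :: 'k)"
          then have "of_int (i - j) = (0 :: 'k)" by simp
          then show "i = j" using zero by fastforce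
        qed
      qed (rule bij_is_inj)
    qed
    moreover have "alg_indep m X" using seed(3) X by (rule alg_indep_cong)
    ultimately interpret generic_cluster m n X B
      by unfold_locales (use assms seed in \<open>auto simp: X_def\<close>)
    have vars: "\<exists>w i. set w \<subseteq> {..<n} \<and> i < m \<and> y = path_cluster m w X B i"
      if y: "y \<in> cluster_vars m n x B" for y
    proof -
      obtain w i where w: "set w \<subseteq> {..<n}" "i < n" "y = path_cluster m w x B i"
        using y by (rule cluster_vars_path)
      moreover have "path_cluster m w x B i = path_cluster m w X B i"
        by (rule path_extend(1)[OF order_refl n_le_m w(1)]) (use w(2) n_le_m in \<open>auto simp: X_def\<close>)
      ultimately show ?thesis using n_le_m by (metis less_le_trans)
    qed
    \<comment> \<open>The ring of the initial cluster shows that units are monomials and controls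
      the exponents at \<open>p \<le> i\<close>.\<close>
    have A1: "?A \<subseteq> laurent_ring {p..<m} m X"
    proof (rule cluster_algebra_subset[OF nonvanishing_x])
      show "cluster_vars m n x B \<subseteq> laurent_ring {p..<m} m X"
      proof
        fix y assume "y \<in> cluster_vars m n x B"
        then obtain w i where w: "set w \<subseteq> {..<n}" and i: "i < m" and y: "y = path_cluster m w X B i"
          using vars by blast
        show "y \<in> laurent_ring {p..<m} m X"
          unfolding y using assms(3) by (intro path_in_laurent_ring[OF w i skew _ regular_path_x[OF w]]) auto
      qed
      show "x i \<in> laurent_ring {p..<m} m X" if "n \<le> i" "i < p" for i
        using laurent_ring_powi[of i m "{p..<m}" 1 X] that assms(2) X by simp
      show "inverse (x i) \<in> laurent_ring {p..<m} m X" if "n \<le> i" "i < p" for i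
        using laurent_ring_powi[of i m "{p..<m}" "- 1" X] that assms(2) X by simp
      show "x i \<in> laurent_ring {p..<m} m X" if "p \<le> i" "i < m" for i
        using laurent_ring_powi[of i m "{p..<m}" 1 X] that X by simp
    qed
    \<comment> \<open>The rings of the adjacent clusters control the exponents of the mutable
      variables.\<close>
    have A2: "?A \<subseteq> laurent_ring {} m (cmut m k X B)" if k: "k < n" for k
    proof (rule cluster_algebra_subset[OF nonvanishing_cmut[OF k]])
      show "cluster_vars m n x B \<subseteq> laurent_ring {} m (cmut m k X B)"
        using vars path_in_mutated_laurent_ring[OF _ _ k] by auto
      have cmut: "cmut m k X B i = x i" if "n \<le> i" "i < m" for i
        using that k X by (simp add: cmut_def)
      show "x i \<in> laurent_ring {} m (cmut m k X B)" if "n \<le> i" "i < p" for i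
        using laurent_ring_powi[of i m "{}" 1 "cmut m k X B"] that assms(2) cmut by simp
      show "inverse (x i) \<in> laurent_ring {} m (cmut m k X B)" if "n \<le> i" "i < p" for i
        using laurent_ring_powi[of i m "{}" "- 1" "cmut m k X B"] that assms(2) cmut by simp
      show "x i \<in> laurent_ring {} m (cmut m k X B)" if "p \<le> i" "i < m" for i
        using laurent_ring_powi[of i m "{}" 1 "cmut m k X B"] that assms(3) cmut by simp
    qed
    obtain f where f: "u = lev rconst X f" "adm {p..<m} m f"
      using A1 u by (meson laurent_ringE subsetD)
    obtain g where g: "v = lev rconst X g" "adm {p..<m} m g"
      using A1 v by (meson laurent_ringE subsetD)
    have "f * g = 1"
    proof (rule independent_eq)
      show "lvars (f * g) \<subseteq> {..<m}" using adm_mult[OF f(2) g(2)] by (simp add: adm_def)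
      show "lev rconst X (f * g) = lev rconst X 1" using uv f(1) g(1) nonvanishing_x by simp
    qed (simp add: lvars_1)
    then obtain a c c' where fa: "f = single a c" and ga: "g = single (- a) c'" and cc': "c * c' = 1"
      by (rule laurent_unit)
    have nz: "c \<noteq> 0" "c' \<noteq> 0" using cc' by auto
    have dvd: "c dvd 1" "c' dvd 1" using dvd_triv_left[of c c'] dvd_triv_right[of c' c] by (simp_all add: cc')
    have keys_a: "keys a \<subseteq> {..<m}" using f(2) nz by (simp add: fa adm_def lvars_def)
    have u_eq: "u = rconst c * mev X a" and v_eq: "v = rconst c' * mev X (- a)"
      using f(1) g(1) by (simp_all add: fa ga)
    \<comment> \<open>The exponents of \<open>u\<close> and of its inverse \<open>v\<close> are
      opposite, and here both are nonnegative.\<close>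
    have frozen: "lookup a i = 0" if "p \<le> i" "i < m" for i
    proof -
      have "lookup a i \<ge> 0" "lookup (- a) i \<ge> 0"
        using f(2) g(2) that nz by (simp_all add: fa ga adm_def)
      then show ?thesis by simp
    qed
    \<comment> \<open>Both \<open>u\<close> and \<open>v\<close> lie in the ring of the cluster
      mutated at \<open>k\<close>, which bounds \<open>lookup a k\<close> from both sides.\<close>
    have mutable: "lookup a k = 0" if k: "k < n" for k
    proof -
      obtain i where i: "i < m" "B i k \<noteq> 0"
        by (rule connected_column_nonzero[OF seed(1,2) assms(5) n_le_m k])
      have "lookup a k \<ge> 0"
        by (rule monomial_in_mutated_ring[OF _ dvd(1) keys_a k i]) (use A2[OF k] u u_eq in blast)
      moreover have "lookup (- a) k \<ge> 0"
        by (rule monomial_in_mutated_ring[OF _ dvd(2) _ k i]) (use A2[OF k] v v_eq keys_a in auto)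
      ultimately show ?thesis by simp
    qed
    have "keys a \<subseteq> {n..<p}"
    proof
      fix i assume "i \<in> keys a"
      then have "i < m" "lookup a i \<noteq> 0" using keys_a by (auto simp: in_keys_iff)
      then show "i \<in> {n..<p}" using frozen[of i] mutable[of i] by (cases "i < n"; cases "i < p") auto
    qed
    then have "mev X a = (\<Prod>i\<in>{n..<p}. x i powi lookup a i)"
      using assms(2) by (simp add: mev_superset[of "{n..<p}"] X)
    then show "u \<in> {rconst c * (\<Prod>i \<in> {n..<p}. x i powi a i) | (c :: 'k) (a :: nat \<Rightarrow> int). c dvd 1}"
      using u_eq dvd(1) by (intro CollectI exI[of _ c] exI[of _ "lookup a"]) simp
  }
qed

end
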